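(* Let $ABC$ be a (non-degenerate) triangle and let $\alpha,\beta,\gamma\in(0,\pi)$ with $\alpha+\beta+\gamma=\pi$. Then there exist a unique triangle $EFD\in\mathcal{I}_{\alpha\beta\gamma}$ which is area-minimizing in the class $\mathcal{I}_{\alpha\beta\gamma}$, along with a unique triangle $QRS\in\mathcal{C}_{\alpha\beta\gamma}$ which is area-maximizing in the class $\mathcal{C}_{\alpha\beta\gamma}$. In addition, these triangles enjoy the following properties: (i) The triangles $EFD$ and $QRS$ are homotopic. (ii) The triangles $EFD$ and $QRS$ are the pedal and the antipedal triangles of some points $K$ and $L$, respectively, with respect to $ABC$. (iii) Let $T$ be the concurrence point of the perpendiculars dropped from $Q$, $R$, $S$ onto the sides $BC$, $AC$, $AB$, respectively, of triangle $ABC$. Then the pairs of points $(L,K)$ and $(T,L)$ are isogonal in the triangles $ABC$ and $QRS$, respectively. (iv) If $O$ is the homotopy center of the triangles $EFD$ and $QRS$, then $O$, $K$, $T$ lie on the same line.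
   Context: Fix the triangle $ABC$ and angles $\alpha,\beta,\gamma$. $\mathcal{I}_{\alpha\beta\gamma}$ is the set of all triangles $XYZ$ with $X,Y,Z$ belonging, respectively, to the lines $BC$, $AC$, $AB$, and whose (unoriented) angles at $X,Y,Z$ are $\alpha,\beta,\gamma$, in this order. $\mathcal{C}_{\alpha\beta\gamma}$ is the set of all triangles $XYZ$ such that $A,B,C$ belong, respectively, to the lines $YZ$, $XZ$, $XY$, and whose (unoriented) angles at $X,Y,Z$ are $\alpha,\beta,\gamma$, in this order. Thus for $EFD\in\mathcal{I}_{\alpha\beta\gamma}$ one has $E\in BC$, $F\in AC$, $D\in AB$, with angles $\alpha,\beta,\gamma$ at $E,F,D$; and for $QRS\in\mathcal{C}_{\alpha\beta\gamma}$ one has $A\in RS$, $B\in QS$, $C\in QR$, with angles $\alpha,\beta,\gamma$ at $Q,R,S$. A triangle is area-minimizing (area-maximizing) in a class if it belongs to the class and has the smallest (largest) area among all triangles in it. Two triangles are homotopic if their corresponding sides are parallel (here the correspondence is $E\leftrightarrow Q$, $F\leftrightarrow R$, $D\leftrightarrow S$); the homotopy center is the concurrence point of the lines through corresponding vertices. The pedal triangle of a point $P$ with respect to $ABC$ is the triangle whose vertices are the orthogonal projections of $P$ onto the side lines of $ABC$. The antipedal triangle of a point $P$ with respect to $ABC$ is the triangle whose vertices are the pairwise intersection points of the perpendiculars to $PA$, $PB$, $PC$ passing through $A$, $B$, $C$, respectively. The isogonal of a point $P$ in a triangle $ABC$ is the concurrence point of the reflections of the lines $PA$, $PB$, $PC$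 across the angle bisectors at $A$, $B$, $C$, respectively; a pair of points is isogonal in a triangle if each is the isogonal of the other. *)

theory Defs
  imports "HOL-Analysis.Analysis"
begin

type_synonym point = "real^2"

section \<open>Lines\<close>

definition line :: "point set \<Rightarrow> bool" where
  "line l \<longleftrightarrow> affine l \<and> aff_dim l = 1"

definition line_through :: "point \<Rightarrow> point \<Rightarrow> point set" where
  "line_through U V = affine hull {U, V}"

text \<open>
  ``The line through \<open>P\<close> and \<open>V\<close>'' as a relation.  For \<open>P \<noteq> V\<close> only \<open>line_through P V\<close>
  satisfies it; for \<open>P = V\<close> every line through the point does.  This matters below:
  the points \<open>L\<close> and \<open>T\<close> of the theorem may coincide with a vertex of the reference triangle
  (for instance \<open>L = A\<close> exactly when the angle of \<open>ABC\<close> at \<open>A\<close> is \<open>\<pi> - \<alpha>\<close>), and then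
  ``the line \<open>PA\<close>'' in the definitions of antipedal triangle and isogonal point only makes
  sense as some line through \<open>A\<close>.
\<close>
definition joins :: "point set \<Rightarrow> point \<Rightarrow> point \<Rightarrow> bool" where
  "joins l P V \<longleftrightarrow> line l \<and> P \<in> l \<and> V \<in> l"

definition perp_through :: "point \<Rightarrow> point set \<Rightarrow> point set" where
  "perp_through P l = {X. \<forall>U\<in>l. \<forall>V\<in>l. orthogonal (X - P) (V - U)}"

definition is_projection :: "point set \<Rightarrow> point \<Rightarrow> point \<Rightarrow> bool" where
  "is_projection l P X \<longleftrightarrow> X \<in> l \<and> X \<in> perp_through P l"

definition reflect_across :: "point set \<Rightarrow> point set \<Rightarrow> point set" where
  "reflect_across l m = {Y. \<exists>X\<in>m. is_projection l X (midpoint X Y)}"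

definition concur_at :: "point set \<Rightarrow> point set \<Rightarrow> point set \<Rightarrow> point \<Rightarrow> bool" where
  "concur_at l m n P \<longleftrightarrow> l \<inter> m \<inter> n = {P}"

section \<open>Triangles, angles and areas\<close>

definition triangle :: "point \<Rightarrow> point \<Rightarrow> point \<Rightarrow> bool" where
  "triangle X Y Z \<longleftrightarrow> \<not> collinear {X, Y, Z}"

definition angle :: "point \<Rightarrow> point \<Rightarrow> point \<Rightarrow> real" where
  "angle Y X Z = arccos ((Y - X) \<bullet> (Z - X) / (norm (Y - X) * norm (Z - X)))"

definition has_angles :: "real \<Rightarrow> real \<Rightarrow> real \<Rightarrow> point \<Rightarrow> point \<Rightarrow> point \<Rightarrow> bool" where
  "has_angles \<alpha> \<beta> \<gamma> X Y Z \<longleftrightarrow> angle Y X Z = \<alpha> \<and> angle X Y Z = \<beta> \<and> angle X Z Y = \<gamma>"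

definition triangle_area :: "point \<times> point \<times> point \<Rightarrow> real" where
  "triangle_area = (\<lambda>(X, Y, Z). measure lebesgue (convex hull {X, Y, Z}))"

text \<open>
  The bisector of the angle at \<open>A\<close> of a triangle \<open>ABC\<close>, as a full line.  On the ray opposite to
  the interior bisector the two angles agree as well (both are \<open>\<pi>\<close> minus half the angle at \<open>A\<close>),
  and \<open>X = A\<close> is included because \<open>angle\<close> then evaluates to \<open>arccos 0\<close> on both sides;
  points of the exterior bisector other than \<open>A\<close> are excluded.
\<close>
definition angle_bisector :: "point \<Rightarrow> point \<Rightarrow> point \<Rightarrow> point set" where
  "angle_bisector B A C = {X. angle X A B = angle X A C}"

section \<open>Inscribed and circumscribed triangles of given angles\<close>

definition inscribed_class ::
  "point \<Rightarrow> point \<Rightarrow> point \<Rightarrow> real \<Rightarrow> real \<Rightarrow> real \<Rightarrow> (point \<times> point \<times> point) set" where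
  "inscribed_class A B C \<alpha> \<beta> \<gamma> =
     {(X, Y, Z). triangle X Y Z \<and>
        X \<in> line_through B C \<and> Y \<in> line_through A C \<and> Z \<in> line_through A B \<and>
        has_angles \<alpha> \<beta> \<gamma> X Y Z}"

definition circumscribed_class ::
  "point \<Rightarrow> point \<Rightarrow> point \<Rightarrow> real \<Rightarrow> real \<Rightarrow> real \<Rightarrow> (point \<times> point \<times> point) set" where
  "circumscribed_class A B C \<alpha> \<beta> \<gamma> =
     {(X, Y, Z). triangle X Y Z \<and>
        A \<in> line_through Y Z \<and> B \<in> line_through X Z \<and> C \<in> line_through X Y \<and>
        has_angles \<alpha> \<beta> \<gamma> X Y Z}"

definition area_minimizing ::
  "(point \<times> point \<times> point) set \<Rightarrow> point \<times> point \<times> point \<Rightarrow> bool" where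
  "area_minimizing \<T> t \<longleftrightarrow> t \<in> \<T> \<and> (\<forall>s\<in>\<T>. triangle_area t \<le> triangle_area s)"

definition area_maximizing ::
  "(point \<times> point \<times> point) set \<Rightarrow> point \<times> point \<times> point \<Rightarrow> bool" where
  "area_maximizing \<T> t \<longleftrightarrow> t \<in> \<T> \<and> (\<forall>s\<in>\<T>. triangle_area s \<le> triangle_area t)"

section \<open>Homotopic triangles\<close>

text \<open>
  Parallel lines are allowed to coincide: a side line of the minimizing triangle may equal
  the corresponding side line of the maximizing one.
\<close>
definition homotopic :: "point \<times> point \<times> point \<Rightarrow> point \<times> point \<times> point \<Rightarrow> bool" where
  "homotopic = (\<lambda>(E, F, D) (Q, R, S).
     affine_parallel (line_through E F) (line_through Q R) \<and>
     affine_parallel (line_through F D) (line_through R S) \<and>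
     affine_parallel (line_through D E) (line_through S Q))"

text \<open>
  If two corresponding vertices coincide (which can happen), \<open>line_through\<close> yields the singleton
  of that vertex, and this vertex is indeed the center of the homothety.
\<close>
definition homotopy_center ::
  "point \<times> point \<times> point \<Rightarrow> point \<times> point \<times> point \<Rightarrow> point \<Rightarrow> bool" where
  "homotopy_center = (\<lambda>(E, F, D) (Q, R, S) P.
     concur_at (line_through E Q) (line_through F R) (line_through D S) P)"

section \<open>Pedal and antipedal triangles, isogonal points\<close>

definition pedal_triangle ::
  "point \<Rightarrow> point \<Rightarrow> point \<Rightarrow> point \<Rightarrow> point \<times> point \<times> point \<Rightarrow> bool" where
  "pedal_triangle A B C P = (\<lambda>(X, Y, Z).
     is_projection (line_through B C) P X \<and>
     is_projection (line_through A C) P Y \<and>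
     is_projection (line_through A B) P Z)"

definition antipedal_triangle ::
  "point \<Rightarrow> point \<Rightarrow> point \<Rightarrow> point \<Rightarrow> point \<times> point \<times> point \<Rightarrow> bool" where
  "antipedal_triangle A B C P = (\<lambda>(X, Y, Z).
     \<exists>a b c. joins a P A \<and> joins b P B \<and> joins c P C \<and>
       perp_through B b \<inter> perp_through C c = {X} \<and>
       perp_through A a \<inter> perp_through C c = {Y} \<and>
       perp_through A a \<inter> perp_through B b = {Z})"

definition is_isogonal :: "point \<Rightarrow> point \<Rightarrow> point \<Rightarrow> point \<Rightarrow> point \<Rightarrow> bool" where
  "is_isogonal A B C P P' \<longleftrightarrow>
     (\<exists>a b c. joins a P A \<and> joins b P B \<and> joins c P C \<and>
       concur_at (reflect_across (angle_bisector B A C) a)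
                 (reflect_across (angle_bisector A B C) b)
                 (reflect_across (angle_bisector A C B) c) P')"

definition isogonal_pair :: "point \<Rightarrow> point \<Rightarrow> point \<Rightarrow> point \<Rightarrow> point \<Rightarrow> bool" where
  "isogonal_pair A B C P P' \<longleftrightarrow> is_isogonal A B C P P' \<and> is_isogonal A B C P' P"

end

theory Submission
  imports Defs
begin

text \<open>
  Unoriented angles fix the shape of a triangle up to orientation. A triangle \<open>XYZ\<close> of
  a fixed oriented shape is given by \<open>X\<close> and the base vector \<open>v = Y - X\<close>,
  namely \<open>Z = X + p v + s J v\<close> with \<open>J\<close> the quarter turn, and its area is
  \<open>\<bar>s\<bar> (v \<bullet> v) / 2\<close>. The three incidence conditions of either class
  are affine in \<open>X\<close>, and \<open>X\<close> can be eliminated. With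
  \<open>\<Delta>\<close> the signed double area of \<open>ABC\<close> and a vector \<open>N\<close>
  depending only on \<open>ABC\<close> and the shape, an inscribed triangle satisfies \<open>N
  \<bullet> v = - \<Delta>\<close> and a circumscribed one \<open>N \<bullet> v = - s (v \<bullet>
  v)\<close> (\<open>pivot_inscribed\<close> and \<open>pivot_circumscribed\<close>). Thus the base
  vectors of inscribed triangles lie on a line perpendicular to \<open>N\<close> (there are none if
  \<open>N = 0\<close>), and those of circumscribed triangles on a circle through the origin with a
  diameter along \<open>N\<close>. The shortest vector of the line and the longest one of the circle
  are unique, are multiples of \<open>N\<close>, and each determines its triangle. The two
  orientations are compared by \<open>pivot_norm_diff\<close>: the squared length of
  \<open>N\<close> for the orientation of \<open>ABC\<close> exceeds the other by \<open>4 \<bar>s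
  \<Delta>\<bar>\<close>. So the extremal triangles are unique in the whole classes and both have
  the orientation of \<open>ABC\<close>.

  Both extremal base vectors are multiples of the same \<open>N\<close>, so a homothety or a
  translation takes \<open>EFD\<close> to \<open>QRS\<close>. It is a homothety, of ratio \<open>k =
  (N \<bullet> N) / (s \<Delta>) \<ge> 4\<close>, and its center is the homotopy center. Base
  vectors parallel to \<open>N\<close> are exactly what makes the perpendiculars defining
  \<open>K\<close> and \<open>L\<close> concurrent. The homothety maps \<open>K\<close> to
  \<open>T\<close>, whence the collinearity.

  Both isogonality claims are one lemma, \<open>isogonal_pair_pedal\<close>: if \<open>P\<close> has
  a nondegenerate pedal triangle in \<open>ABC\<close> and the line through each vertex
  perpendicular to the pedal side facing it passes through \<open>P'\<close>, then \<open>P\<close>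
  and \<open>P'\<close> are isogonal. It applies to \<open>K\<close> and \<open>L\<close> in
  \<open>ABC\<close>, because the sides of \<open>QRS\<close> are parallel to those of
  \<open>EFD\<close>, and to \<open>L\<close> and \<open>T\<close> in \<open>QRS\<close>, where the
  pedal triangle of \<open>L\<close> is \<open>ABC\<close>.
\<close>

section \<open>Plane vector algebra\<close>

text \<open>The rotation by a right angle in the positive direction.\<close>
definition rot90 :: "point \<Rightarrow> point" where
  "rot90 u = vector [- (u $ 2), u $ 1]"

text \<open>The determinant with columns \<open>u\<close> and \<open>v\<close>: the signed area of the parallelogram they span.\<close>
definition crs :: "point \<Rightarrow> point \<Rightarrow> real" where
  "crs u v = rot90 u \<bullet> v"

lemma rot90_component [simp]: "rot90 u $ 1 = - (u $ 2)" "rot90 u $ 2 = u $ 1"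
  by (simp_all add: rot90_def)

lemma inner_coords: "u \<bullet> v = u $ 1 * v $ 1 + u $ 2 * v $ 2" for u v :: point
  by (simp add: inner_vec_def sum_2)

lemma crs_coords: "crs u v = u $ 1 * v $ 2 - u $ 2 * v $ 1"
  by (simp add: crs_def inner_coords)

lemma point_eq_iff: "u = v \<longleftrightarrow> u $ 1 = v $ 1 \<and> u $ 2 = v $ 2" for u v :: point
  by (simp add: vec_eq_iff forall_2)

lemma rot90_diff: "rot90 (u - v) = rot90 u - rot90 v"
  by (simp add: point_eq_iff)

lemma rot90_scale [simp]:
  "rot90 (c *\<^sub>R u) = c *\<^sub>R rot90 u" "rot90 (- u) = - rot90 u" "rot90 0 = 0"
  by (simp_all add: point_eq_iff)

lemma rot90_rot90 [simp]: "rot90 (rot90 u) = - u"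
  by (simp add: point_eq_iff)

lemma rot90_inner [simp]:
  "rot90 u \<bullet> u = 0" "u \<bullet> rot90 u = 0" "rot90 u \<bullet> rot90 v = u \<bullet> v"
  by (simp_all add: inner_coords)

lemma rot90_eq_0_iff [simp]: "rot90 u = 0 \<longleftrightarrow> u = 0"
  by (auto simp: point_eq_iff)

lemma orthogonal_imp_scaled_rot90:
  fixes n x :: point
  assumes "n \<noteq> 0" "n \<bullet> x = 0"
  obtains c where "x = c *\<^sub>R rot90 n"
proof -
  have "(n \<bullet> n) *\<^sub>R x = (n \<bullet> x) *\<^sub>R n + (rot90 n \<bullet> x) *\<^sub>R rot90 n"
    by (simp add: point_eq_iff inner_coords algebra_simps)
  then have "(n \<bullet> n) *\<^sub>R x = (rot90 n \<bullet> x) *\<^sub>R rot90 n" using assms by simp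
  then have "(1 / (n \<bullet> n)) *\<^sub>R ((n \<bullet> n) *\<^sub>R x) = (1 / (n \<bullet> n)) *\<^sub>R ((rot90 n \<bullet> x) *\<^sub>R rot90 n)"
    by simp
  then have "x = ((rot90 n \<bullet> x) / (n \<bullet> n)) *\<^sub>R rot90 n" using assms(1) by simp
  then show thesis using that by blast
qed

lemma crs_eq_0_imp_scaled:
  assumes "u \<noteq> 0" "crs u v = 0"
  obtains c where "v = c *\<^sub>R u"
proof -
  from assms obtain c where "v = c *\<^sub>R rot90 (rot90 u)"
    using orthogonal_imp_scaled_rot90[of "rot90 u" v] by (auto simp: crs_def)
  then have "v = (- c) *\<^sub>R u" by simp
  then show thesis using that by blast
qed

lemma cramer:
  fixes m n :: point
  assumes "crs m n \<noteq> 0"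
  shows "\<exists>!x. m \<bullet> x = c \<and> n \<bullet> x = d"
proof (rule ex1I)
  let ?x = "(1 / crs m n) *\<^sub>R (d *\<^sub>R rot90 m - c *\<^sub>R rot90 n)"
  have "m \<bullet> rot90 n = - crs m n" "n \<bullet> rot90 m = crs m n"
    by (simp_all add: inner_coords crs_coords)
  then show "m \<bullet> ?x = c \<and> n \<bullet> ?x = d"
    using assms by (simp add: inner_diff_right)
  fix y assume y: "m \<bullet> y = c \<and> n \<bullet> y = d"
  have "crs m n *\<^sub>R y = (n \<bullet> y) *\<^sub>R rot90 m - (m \<bullet> y) *\<^sub>R rot90 n"
    by (simp add: point_eq_iff inner_coords crs_coords algebra_simps)
  then have "(1 / crs m n) *\<^sub>R (crs m n *\<^sub>R y) = ?x" using y by simp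
  then show "y = ?x" using assms by simp
qed

lemma triangle_iff_crs: "triangle A B C \<longleftrightarrow> crs (B - A) (C - A) \<noteq> 0"
proof -
  have "collinear {A, B, C} \<longleftrightarrow> collinear {0, B - A, C - A}"
    using collinear_3[of B A C] by (simp add: NO_MATCH_def insert_commute)
  also have "\<dots> \<longleftrightarrow> crs (B - A) (C - A) = 0"
    unfolding collinear_lemma
  proof
    assume "crs (B - A) (C - A) = 0"
    then show "B - A = 0 \<or> C - A = 0 \<or> (\<exists>c. C - A = c *\<^sub>R (B - A))"
      using crs_eq_0_imp_scaled by blast
  qed (auto simp: crs_def)
  finally show ?thesis by (simp add: triangle_def)
qed

section \<open>Lines in normal form\<close>

text \<open>The line through \<open>P\<close> with normal vector \<open>n\<close>, which need not be a unit vector.  For \<open>n = 0\<close>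
  it is the whole plane, so statements about lines assume \<open>n \<noteq> 0\<close>.\<close>
definition normal_line :: "point \<Rightarrow> point \<Rightarrow> point set" where
  "normal_line n P = {X. n \<bullet> (X - P) = 0}"

lemma mem_normal_line: "X \<in> normal_line n P \<longleftrightarrow> n \<bullet> (X - P) = 0"
  by (simp add: normal_line_def)

lemma line_normal_line:
  assumes "n \<noteq> 0"
  shows "line (normal_line n P)"
proof -
  have "normal_line n P = {x. n \<bullet> x = n \<bullet> P}"
    by (auto simp: normal_line_def inner_diff_right)
  then show ?thesis
    unfolding line_def using assms by (simp add: affine_hyperplane)
qed

lemma line_through_eq:
  assumes "U \<noteq> V"
  shows "line_through U V = normal_line (rot90 (V - U)) U"
proof (intro set_eqI iffI)
  fix X assume "X \<in> line_through U V"
  then obtain a b where "X = a *\<^sub>R U + b *\<^sub>R V" and "a + b = 1"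
    by (auto simp: line_through_def affine_hull_2)
  then have "X = (1 - b) *\<^sub>R U + b *\<^sub>R V" by (metis add_diff_cancel_right')
  then have "X - U = b *\<^sub>R (V - U)"
    by (simp add: algebra_simps flip: scaleR_left_distrib)
  then show "X \<in> normal_line (rot90 (V - U)) U"
    by (simp only: mem_normal_line) simp
next
  fix X assume "X \<in> normal_line (rot90 (V - U)) U"
  then have "crs (V - U) (X - U) = 0" by (simp only: mem_normal_line crs_def)
  then obtain b where "X - U = b *\<^sub>R (V - U)"
    using assms crs_eq_0_imp_scaled[of "V - U" "X - U"] by auto
  then have "X = (1 - b) *\<^sub>R U + b *\<^sub>R V" by (simp add: algebra_simps)
  then show "X \<in> line_through U V"
    unfolding line_through_def affine_hull_2 by force
qed

lemma perp_through_normal_line: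
  assumes "n \<noteq> 0"
  shows "perp_through P (normal_line n Q) = normal_line (rot90 n) P"
proof (intro set_eqI iffI)
  fix X assume "X \<in> perp_through P (normal_line n Q)"
  moreover have "Q \<in> normal_line n Q" "Q + rot90 n \<in> normal_line n Q"
    by (simp_all add: mem_normal_line)
  ultimately have "orthogonal (X - P) (Q + rot90 n - Q)"
    unfolding perp_through_def by blast
  then show "X \<in> normal_line (rot90 n) P"
    by (simp add: mem_normal_line orthogonal_def inner_commute)
next
  fix X assume X: "X \<in> normal_line (rot90 n) P"
  have "(X - P) \<bullet> (V - U) = 0" if "U \<in> normal_line n Q" "V \<in> normal_line n Q" for U V
  proof -
    have "n \<bullet> (V - U) = 0" using that by (simp add: mem_normal_line inner_diff_right)
    then obtain c where "V - U = c *\<^sub>R rot90 n" using orthogonal_imp_scaled_rot90 assms by blast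
    then show ?thesis using X by (simp add: mem_normal_line inner_commute)
  qed
  then show "X \<in> perp_through P (normal_line n Q)"
    by (simp add: perp_through_def orthogonal_def)
qed

lemma normal_line_scale: "c \<noteq> 0 \<Longrightarrow> normal_line (c *\<^sub>R n) P = normal_line n P"
  by (simp add: normal_line_def)

lemma perp_through_line_through:
  assumes "U \<noteq> V"
  shows "perp_through P (line_through U V) = normal_line (V - U) P"
proof -
  have "perp_through P (line_through U V) = normal_line (- (V - U)) P"
    unfolding line_through_eq[OF assms]
    using assms by (subst perp_through_normal_line) (simp_all only: rot90_rot90 rot90_eq_0_iff, simp)
  then show ?thesis using normal_line_scale[of "- 1" "V - U" P] by simp
qed

lemma line_through_commute: "line_through U V = line_through V U"
  by (simp add: line_through_def insert_commute)

lemma mem_line_through: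
  assumes "U \<noteq> V"
  shows "X \<in> line_through U V \<longleftrightarrow> crs (V - U) (X - U) = 0"
  using assms by (simp add: line_through_eq mem_normal_line crs_def)

lemma is_projection_line_through:
  assumes "U \<noteq> V"
  shows "is_projection (line_through U V) P X \<longleftrightarrow>
    crs (V - U) (X - U) = 0 \<and> (V - U) \<bullet> (X - P) = 0"
  using assms
  by (simp add: is_projection_def mem_line_through perp_through_line_through mem_normal_line)

lemma affine_parallel_normal_line:
  assumes "c \<noteq> 0"
  shows "affine_parallel (normal_line n P) (normal_line (c *\<^sub>R n) Q)"
proof -
  have "normal_line (c *\<^sub>R n) Q = (\<lambda>x. (Q - P) + x) ` normal_line n P"
  proof (intro set_eqI iffI)
    fix x assume "x \<in> normal_line (c *\<^sub>R n) Q"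
    then have "x - (Q - P) \<in> normal_line n P" using assms by (simp add: mem_normal_line)
    then show "x \<in> (\<lambda>x. (Q - P) + x) ` normal_line n P"
      by (metis (no_types, lifting) add.commute diff_add_cancel image_eqI)
  qed (auto simp: mem_normal_line)
  then show ?thesis by (auto simp: affine_parallel_def)
qed

lemma inter_normal_line:
  assumes "crs m n \<noteq> 0" "X \<in> normal_line m P" "X \<in> normal_line n Q"
  shows "normal_line m P \<inter> normal_line n Q = {X}"
proof -
  have "\<exists>!x. m \<bullet> x = m \<bullet> P \<and> n \<bullet> x = n \<bullet> Q" using assms(1) by (rule cramer)
  then show ?thesis using assms(2,3) by (auto simp: normal_line_def inner_diff_right)
qed

text \<open>A nonzero vector cannot be parallel to all three lines from a point \<open>P\<close> to the vertices of a
  triangle.  The point \<open>P\<close> may be a vertex.\<close>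
lemma triangle_vanish:
  assumes "triangle A B C" "\<And>V. V \<in> {A, B, C} \<Longrightarrow> crs x (V - P) = 0"
  shows "x = 0"
proof (rule ccontr)
  assume "x \<noteq> 0"
  have "crs x (A - P) = 0" "crs x (B - P) = 0" "crs x (C - P) = 0" using assms(2) by auto
  then obtain a b c where "A - P = a *\<^sub>R x" "B - P = b *\<^sub>R x" "C - P = c *\<^sub>R x"
    using \<open>x \<noteq> 0\<close> crs_eq_0_imp_scaled by metis
  then have "(B - P) - (A - P) = (b - a) *\<^sub>R x" "(C - P) - (A - P) = (c - a) *\<^sub>R x"
    by (simp_all add: scaleR_left_diff_distrib)
  then have "crs (B - A) (C - A) = 0" by (simp add: crs_coords)
  then show False using assms(1) by (simp add: triangle_iff_crs)
qed

text \<open>Lines through the vertices of a triangle cannot all coincide, so they have at most one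
  common point.\<close>
lemma concur_at_normal_lines:
  assumes "triangle A B C" "l \<noteq> 0" "m \<noteq> 0" "n \<noteq> 0"
    and "P \<in> normal_line l A" "P \<in> normal_line m B" "P \<in> normal_line n C"
  shows "concur_at (normal_line l A) (normal_line m B) (normal_line n C) P"
proof -
  have dir: "crs (X - P) (V - P) = 0"
    if "k \<noteq> 0" "P \<in> normal_line k V" "X \<in> normal_line k V" for k V X
  proof -
    have "k \<bullet> (X - P) = 0" "k \<bullet> (V - P) = 0"
      using that by (simp_all add: mem_normal_line inner_diff_right)
    then obtain a b where "X - P = a *\<^sub>R rot90 k" "V - P = b *\<^sub>R rot90 k"
      using orthogonal_imp_scaled_rot90 \<open>k \<noteq> 0\<close> by metis
    then show ?thesis by (simp add: crs_coords)
  qed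
  have "X = P" if "X \<in> normal_line l A \<inter> normal_line m B \<inter> normal_line n C" for X
    using triangle_vanish[OF assms(1), of "X - P" P] dir assms that by auto
  then show ?thesis using assms unfolding concur_at_def by blast
qed

section \<open>Isogonal points\<close>

text \<open>The reflection in the line through the origin with normal vector \<open>d\<close>.\<close>
definition reflect_vec :: "point \<Rightarrow> point \<Rightarrow> point" where
  "reflect_vec d x = x - (2 * (d \<bullet> x) / (d \<bullet> d)) *\<^sub>R d"

lemma reflect_vec_involution:
  assumes "d \<noteq> 0" shows "reflect_vec d (reflect_vec d x) = x"
proof -
  have "d \<bullet> reflect_vec d x = - (d \<bullet> x)"
    using assms by (simp add: reflect_vec_def inner_diff_right)
  then show ?thesis by (simp add: reflect_vec_def)
qed

lemma reflect_vec_adjoint: "reflect_vec d x \<bullet> y = x \<bullet> reflect_vec d y"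
  by (simp add: reflect_vec_def inner_diff_right inner_diff_left inner_commute)

lemma reflect_across_normal_line:
  assumes "d \<noteq> 0"
  shows "reflect_across (normal_line d A) (normal_line n A) = normal_line (reflect_vec d n) A"
proof -
  have proj: "is_projection (normal_line d A) X (midpoint X Y) \<longleftrightarrow>
      Y = A + reflect_vec d (X - A)" for X Y
  proof -
    have "is_projection (normal_line d A) X (midpoint X Y) \<longleftrightarrow>
        d \<bullet> (midpoint X Y - A) = 0 \<and> rot90 d \<bullet> (midpoint X Y - X) = 0"
      using assms by (simp add: is_projection_def perp_through_normal_line mem_normal_line)
    also have "\<dots> \<longleftrightarrow> d \<bullet> (X - A) + d \<bullet> (Y - A) = 0 \<and> rot90 d \<bullet> (Y - X) = 0"
      by (simp add: midpoint_def inner_diff_right inner_add_right) (auto simp: field_simps)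
    also have "\<dots> \<longleftrightarrow> Y = A + reflect_vec d (X - A)"
    proof
      assume *: "d \<bullet> (X - A) + d \<bullet> (Y - A) = 0 \<and> rot90 d \<bullet> (Y - X) = 0"
      then obtain c where c: "Y - X = c *\<^sub>R d"
        using crs_eq_0_imp_scaled[OF assms] by (auto simp: crs_def)
      then have Y: "Y = X + c *\<^sub>R d" by (simp add: algebra_simps)
      have "c * (d \<bullet> d) = - 2 * (d \<bullet> (X - A))"
        using * unfolding Y by (simp add: inner_diff_right inner_add_right)
      then have "c = - (2 * (d \<bullet> (X - A)) / (d \<bullet> d))" using assms by (simp add: field_simps)
      then show "Y = A + reflect_vec d (X - A)" by (simp add: Y reflect_vec_def)
    next
      assume "Y = A + reflect_vec d (X - A)"
      then show "d \<bullet> (X - A) + d \<bullet> (Y - A) = 0 \<and> rot90 d \<bullet> (Y - X) = 0"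
        using assms by (simp add: reflect_vec_def inner_diff_right)
    qed
    finally show ?thesis .
  qed
  have "(\<exists>X\<in>normal_line n A. Y = A + reflect_vec d (X - A)) \<longleftrightarrow>
      A + reflect_vec d (Y - A) \<in> normal_line n A" for Y
  proof
    assume "A + reflect_vec d (Y - A) \<in> normal_line n A"
    moreover have "Y = A + reflect_vec d (A + reflect_vec d (Y - A) - A)"
      using reflect_vec_involution[OF assms] by simp
    ultimately show "\<exists>X\<in>normal_line n A. Y = A + reflect_vec d (X - A)" by blast
  qed (auto simp: reflect_vec_involution[OF assms])
  then show ?thesis
    unfolding reflect_across_def proj
    by (auto simp: mem_normal_line reflect_vec_adjoint)
qed

lemma reflect_vec_swap:
  assumes "u \<bullet> u = v \<bullet> v" "u \<noteq> v"
  shows "reflect_vec (u - v) u = v" "reflect_vec (u - v) v = u"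
proof -
  have "(u - v) \<bullet> (u - v) = 2 * ((u - v) \<bullet> u)" "(u - v) \<bullet> (u - v) = - 2 * ((u - v) \<bullet> v)"
    using assms(1) by (simp_all add: inner_diff_left inner_diff_right inner_commute)
  moreover have "(u - v) \<bullet> (u - v) \<noteq> 0" using assms(2) by simp
  ultimately have "2 * ((u - v) \<bullet> u) / ((u - v) \<bullet> (u - v)) = 1"
    "2 * ((u - v) \<bullet> v) / ((u - v) \<bullet> (u - v)) = - 1"
    by (simp_all add: field_simps)
  then show "reflect_vec (u - v) u = v" "reflect_vec (u - v) v = u"
    by (simp_all only: reflect_vec_def) simp_all
qed

text \<open>A reflection reverses orientation, so conjugating it by a quarter turn changes its sign.\<close>
lemma rot90_reflect_vec:
  assumes "d \<noteq> 0"
  shows "rot90 (reflect_vec d (rot90 x)) = reflect_vec d x"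
proof -
  define a b where "a = 2 * (d \<bullet> x) / (d \<bullet> d)" and "b = 2 * (d \<bullet> rot90 x) / (d \<bullet> d)"
  have "(d \<bullet> d) *\<^sub>R x = (d \<bullet> x) *\<^sub>R d - (d \<bullet> rot90 x) *\<^sub>R rot90 d"
    by (simp add: point_eq_iff inner_coords algebra_simps)
  then have "(2 / (d \<bullet> d)) *\<^sub>R ((d \<bullet> d) *\<^sub>R x) =
      (2 / (d \<bullet> d)) *\<^sub>R ((d \<bullet> x) *\<^sub>R d - (d \<bullet> rot90 x) *\<^sub>R rot90 d)" by simp
  then have "2 *\<^sub>R x = a *\<^sub>R d - b *\<^sub>R rot90 d"
    using assms by (simp add: scaleR_right_diff_distrib a_def b_def)
  then have "- x - b *\<^sub>R rot90 d = x - a *\<^sub>R d"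
    unfolding point_eq_iff by simp
  then show ?thesis by (simp add: reflect_vec_def rot90_diff a_def b_def)
qed

lemma cosine_bounds:
  fixes x y :: "'a::real_inner"
  shows "\<bar>x \<bullet> y / (norm x * norm y)\<bar> \<le> 1"
proof (cases "x = 0 \<or> y = 0")
  case False
  then have "0 < norm x * norm y" by simp
  then show ?thesis using Cauchy_Schwarz_ineq2[of x y] by (simp add: abs_divide field_simps)
qed auto

text \<open>The bisector consists of the points \<open>X\<close> for which \<open>X - A\<close> has the same inner product with
  the unit vectors along the two sides, so the difference of these is a normal vector of it.\<close>
lemma angle_bisector_eq:
  assumes "A \<noteq> B" "A \<noteq> C"
  shows "angle_bisector B A C = normal_line (sgn (B - A) - sgn (C - A)) A"
proof -
  have "angle X A B = angle X A C \<longleftrightarrow> (sgn (B - A) - sgn (C - A)) \<bullet> (X - A) = 0" for X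
  proof -
    have "angle X A B = angle X A C \<longleftrightarrow>
        (X - A) \<bullet> (B - A) / (norm (X - A) * norm (B - A)) =
        (X - A) \<bullet> (C - A) / (norm (X - A) * norm (C - A))"
      unfolding angle_def by (rule arccos_eq_iff) (use cosine_bounds in blast)
    also have "\<dots> \<longleftrightarrow> X = A \<or>
        (X - A) \<bullet> (B - A) / norm (B - A) = (X - A) \<bullet> (C - A) / norm (C - A)"
      using assms by (auto simp: divide_simps)
    also have "\<dots> \<longleftrightarrow> (sgn (B - A) - sgn (C - A)) \<bullet> (X - A) = 0"
    proof -
      have "(sgn (B - A) - sgn (C - A)) \<bullet> (X - A) =
          (X - A) \<bullet> (B - A) / norm (B - A) - (X - A) \<bullet> (C - A) / norm (C - A)"
        by (simp add: sgn_div_norm inner_diff_left[of _ _ "X - A"] inner_commute[of "X - A"] divide_inverse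
            mult.commute)
      then show ?thesis by auto
    qed
    finally show ?thesis .
  qed
  then show ?thesis by (simp add: angle_bisector_def normal_line_def)
qed

text \<open>The foot is the component of \<open>P - A\<close> along the unit vector of the side.\<close>
lemma foot_eq_inner_sgn:
  assumes "A \<noteq> B" "is_projection (line_through A B) P Z"
  shows "Z - A = ((P - A) \<bullet> sgn (B - A)) *\<^sub>R sgn (B - A)"
proof -
  have eq: "crs (B - A) (Z - A) = 0" "(B - A) \<bullet> (Z - P) = 0"
    using assms by (simp_all add: is_projection_line_through)
  then obtain z where z: "Z - A = z *\<^sub>R (B - A)"
    using crs_eq_0_imp_scaled[of "B - A" "Z - A"] assms(1) by auto
  have "(P - A) \<bullet> (B - A) = (Z - A) \<bullet> (B - A)"
    using eq(2) by (simp add: inner_diff_left inner_diff_right inner_commute)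
  also have "\<dots> = z * (norm (B - A))\<^sup>2"
    unfolding z by (simp add: power2_norm_eq_inner)
  finally have "(P - A) \<bullet> (B - A) = z * (norm (B - A))\<^sup>2" .
  then show ?thesis unfolding z sgn_div_norm using assms(1) by (simp add: power2_eq_square)
qed

text \<open>
  The isogonal of the line \<open>AP\<close> in the angle at \<open>A\<close> is perpendicular to the side of the pedal
  triangle of \<open>P\<close> facing \<open>A\<close>.  Write \<open>u\<close>, \<open>v\<close> for the unit vectors along the sides at \<open>A\<close> and
  \<open>t = P - A\<close>.  The feet of \<open>P\<close> are \<open>(t \<bullet> u) u\<close> and \<open>(t \<bullet> v) v\<close> relative to \<open>A\<close>.  The
  reflection of \<open>t\<close> in the bisector has inner product \<open>t \<bullet> v\<close> with \<open>u\<close> and \<open>t \<bullet> u\<close> with \<open>v\<close>,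
  because the reflection exchanges \<open>u\<close> and \<open>v\<close>.  Hence it is orthogonal to the difference of the
  two feet.
\<close>
lemma pedal_side_isogonal:
  assumes "triangle A B C"
    and Y: "is_projection (line_through A C) P Y"
    and Z: "is_projection (line_through A B) P Z"
    and "Y \<noteq> Z"
  shows "P \<noteq> A"
    and "reflect_across (angle_bisector B A C) (normal_line (Z - Y) A) =
         normal_line (rot90 (P - A)) A"
    and "reflect_across (angle_bisector B A C) (normal_line (rot90 (P - A)) A) =
         normal_line (Z - Y) A"
proof -
  have nz: "A \<noteq> B" "A \<noteq> C" using assms(1) by (auto simp: triangle_def insert_commute)
  define u v t where "u = sgn (B - A)" and "v = sgn (C - A)" and "t = P - A"
  have ZY: "Z - A = (t \<bullet> u) *\<^sub>R u" "Y - A = (t \<bullet> v) *\<^sub>R v"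
    using foot_eq_inner_sgn nz Y Z by (auto simp: u_def v_def t_def)
  show "P \<noteq> A" using ZY \<open>Y \<noteq> Z\<close> by (auto simp: t_def)
  then have "t \<noteq> 0" by (simp add: t_def)
  have unit: "u \<bullet> u = v \<bullet> v" "u \<noteq> 0" "v \<noteq> 0"
    using nz by (simp_all add: u_def v_def norm_sgn dot_square_norm sgn_zero_iff)
  have "u \<noteq> v"
  proof
    assume "u = v"
    then have "norm (C - A) *\<^sub>R (norm (B - A) *\<^sub>R sgn (B - A)) =
        norm (B - A) *\<^sub>R (norm (C - A) *\<^sub>R sgn (C - A))" by (simp add: u_def v_def mult.commute)
    then have "norm (C - A) *\<^sub>R (B - A) = norm (B - A) *\<^sub>R (C - A)"
      using nz by (simp add: sgn_div_norm)
    then have "norm (B - A) * crs (B - A) (C - A) = crs (B - A) (norm (C - A) *\<^sub>R (B - A))"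
      by (simp add: crs_def)
    then show False using assms(1) nz by (simp add: triangle_iff_crs crs_def)
  qed
  define d where "d = u - v"
  have d: "d \<noteq> 0" "reflect_vec d u = v" "reflect_vec d v = u"
    using \<open>u \<noteq> v\<close> reflect_vec_swap unit(1) by (simp_all add: d_def)
  define r where "r = reflect_vec d (rot90 t)"
  have "r \<noteq> 0"
  proof
    assume "r = 0"
    then have "rot90 t = reflect_vec d 0"
      using reflect_vec_involution[OF d(1), of "rot90 t"] by (simp add: r_def)
    then show False using \<open>t \<noteq> 0\<close> by (simp add: reflect_vec_def)
  qed
  have "crs r (Z - Y) = reflect_vec d t \<bullet> (Z - Y)"
    by (simp add: crs_def r_def rot90_reflect_vec d(1))
  moreover have "Z - Y = (t \<bullet> u) *\<^sub>R u - (t \<bullet> v) *\<^sub>R v" by (simp flip: ZY)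
  then have "reflect_vec d t \<bullet> (Z - Y) = 0"
    by (simp add: inner_diff_right reflect_vec_adjoint d)
  ultimately have "crs r (Z - Y) = 0" by simp
  then obtain c where c: "Z - Y = c *\<^sub>R r"
    using crs_eq_0_imp_scaled[OF \<open>r \<noteq> 0\<close>] by blast
  then have "c \<noteq> 0" using \<open>Y \<noteq> Z\<close> by auto
  then have line: "normal_line (Z - Y) A = normal_line r A" by (simp add: c normal_line_scale)
  have bis: "angle_bisector B A C = normal_line d A"
    using angle_bisector_eq nz by (simp add: d_def u_def v_def)
  show "reflect_across (angle_bisector B A C) (normal_line (Z - Y) A) =
         normal_line (rot90 (P - A)) A"
    unfolding line bis reflect_across_normal_line[OF d(1)]
    by (simp add: r_def reflect_vec_involution d(1) t_def)
  show "reflect_across (angle_bisector B A C) (normal_line (rot90 (P - A)) A) =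
         normal_line (Z - Y) A"
    unfolding line bis reflect_across_normal_line[OF d(1)] by (simp add: r_def t_def)
qed

text \<open>
  The point \<open>P'\<close> may be a vertex of \<open>ABC\<close>; the line joining it to that vertex is then taken to be
  the perpendicular to the pedal side.  The point \<open>P\<close> is never a vertex, since two vertices of its
  pedal triangle would coincide there.
\<close>
lemma isogonal_pair_pedal:
  assumes "triangle A B C" "triangle X Y Z" "pedal_triangle A B C P (X, Y, Z)"
    and "(Z - Y) \<bullet> (P' - A) = 0" "(Z - X) \<bullet> (P' - B) = 0" "(Y - X) \<bullet> (P' - C) = 0"
  shows "isogonal_pair A B C P' P"
proof -
  have ne: "Y \<noteq> Z" "X \<noteq> Z" "X \<noteq> Y" using assms(2) by (auto simp: triangle_def insert_commute)
  have tri: "triangle B A C" "triangle C A B"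
    using assms(1) by (simp_all add: triangle_def insert_commute)
  have X: "is_projection (line_through B C) P X" "is_projection (line_through C B) P X"
    and Y: "is_projection (line_through A C) P Y" "is_projection (line_through C A) P Y"
    and Z: "is_projection (line_through A B) P Z" "is_projection (line_through B A) P Z"
    using assms(3) by (simp_all add: pedal_triangle_def line_through_commute)
  note a = pedal_side_isogonal[OF assms(1) Y(1) Z(1) ne(1)]
  note b = pedal_side_isogonal[OF tri(1) X(1) Z(2) ne(2)]
  note c = pedal_side_isogonal[OF tri(2) X(2) Y(2) ne(3)]
  have joins: "joins (normal_line n V) W V" if "n \<noteq> 0" "W \<in> normal_line n V" for n V W
    using that line_normal_line by (auto simp: joins_def mem_normal_line)
  have P: "P \<in> normal_line (rot90 (P - V)) V" for V
    by (simp add: mem_normal_line)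
  have P': "P' \<in> normal_line (Z - Y) A" "P' \<in> normal_line (Z - X) B" "P' \<in> normal_line (Y - X) C"
    using assms(4-6) by (simp_all add: mem_normal_line)
  have n: "rot90 (P - A) \<noteq> 0" "rot90 (P - B) \<noteq> 0" "rot90 (P - C) \<noteq> 0"
    "Z - Y \<noteq> 0" "Z - X \<noteq> 0" "Y - X \<noteq> 0"
    using a(1) b(1) c(1) ne by simp_all
  have "concur_at (reflect_across (angle_bisector B A C) (normal_line (Z - Y) A))
      (reflect_across (angle_bisector A B C) (normal_line (Z - X) B))
      (reflect_across (angle_bisector A C B) (normal_line (Y - X) C)) P"
    unfolding a(2) b(2) c(2) by (rule concur_at_normal_lines[OF assms(1) n(1-3) P P P])
  then have "is_isogonal A B C P' P"
    unfolding is_isogonal_def using joins[OF n(4) P'(1)] joins[OF n(5) P'(2)] joins[OF n(6) P'(3)]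
    by blast
  moreover have "concur_at (reflect_across (angle_bisector B A C) (normal_line (rot90 (P - A)) A))
      (reflect_across (angle_bisector A B C) (normal_line (rot90 (P - B)) B))
      (reflect_across (angle_bisector A C B) (normal_line (rot90 (P - C)) C)) P'"
    unfolding a(3) b(3) c(3) by (rule concur_at_normal_lines[OF assms(1) n(4-6) P'])
  then have "is_isogonal A B C P P'"
    unfolding is_isogonal_def using joins[OF n(1) P] joins[OF n(2) P] joins[OF n(3) P]
    by blast
  ultimately show ?thesis by (simp add: isogonal_pair_def)
qed

section \<open>Triangles of prescribed shape\<close>

text \<open>
  The third vertex of the triangle on the base \<open>XY\<close> whose altitude has its foot at the fraction \<open>p\<close>
  of the base and has signed length \<open>s\<close> times that of the base.  For fixed \<open>p\<close> and \<open>s\<close> the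
  nondegenerate triangles \<open>XYZ\<close> with \<open>Z = apex p s X Y\<close> are directly similar; \<open>(p, s)\<close> is called
  their shape and \<open>Y - X\<close> their base vector.
\<close>
definition apex :: "real \<Rightarrow> real \<Rightarrow> point \<Rightarrow> point \<Rightarrow> point" where
  "apex p s X Y = X + p *\<^sub>R (Y - X) + s *\<^sub>R rot90 (Y - X)"

lemma apex_coords:
  "apex p s X Y $ 1 = X $ 1 + p * (Y $ 1 - X $ 1) - s * (Y $ 2 - X $ 2)"
  "apex p s X Y $ 2 = X $ 2 + p * (Y $ 2 - X $ 2) + s * (Y $ 1 - X $ 1)"
  by (simp_all add: apex_def algebra_simps)

lemma apex_exists:
  assumes "X \<noteq> Y"
  obtains p s where "Z = apex p s X Y"
proof -
  define v z where "v = Y - X" and "z = Z - X"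
  have "v \<noteq> 0" using assms by (simp add: v_def)
  have "(v \<bullet> v) *\<^sub>R z = (v \<bullet> z) *\<^sub>R v + (rot90 v \<bullet> z) *\<^sub>R rot90 v"
    by (simp add: point_eq_iff inner_coords algebra_simps)
  then have "(1 / (v \<bullet> v)) *\<^sub>R ((v \<bullet> v) *\<^sub>R z) =
      (1 / (v \<bullet> v)) *\<^sub>R ((v \<bullet> z) *\<^sub>R v + (rot90 v \<bullet> z) *\<^sub>R rot90 v)" by simp
  then have "z = ((v \<bullet> z) / (v \<bullet> v)) *\<^sub>R v + ((rot90 v \<bullet> z) / (v \<bullet> v)) *\<^sub>R rot90 v"
    using \<open>v \<noteq> 0\<close> by (simp add: scaleR_right_distrib)
  then have "Z = apex ((v \<bullet> z) / (v \<bullet> v)) ((rot90 v \<bullet> z) / (v \<bullet> v)) X Y"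
    unfolding apex_def v_def[symmetric] by (simp add: z_def add.assoc diff_eq_eq add.commute)
  then show thesis by (rule that)
qed

lemma crs_apex: "crs (Y - X) (apex p s X Y - X) = s * ((Y - X) \<bullet> (Y - X))"
  by (simp add: crs_coords inner_coords apex_coords algebra_simps)

lemma triangle_area_crs: "triangle_area (X, Y, Z) = \<bar>crs (Y - X) (Z - X)\<bar> / 2"
proof -
  have "measure lebesgue (convex hull {X, Y, Z}) = measure lborel (convex hull {X, Y, Z})"
    by (intro measure_completion) (simp add: borel_compact compact_convex_hull finite_imp_compact)
  then show ?thesis
    unfolding triangle_area_def content_triangle by (simp add: crs_coords abs_minus_commute mult.commute)
qed

lemma inner_crs_power2: "(u \<bullet> v)\<^sup>2 + (crs u v)\<^sup>2 = (norm u)\<^sup>2 * (norm v)\<^sup>2"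
  unfolding power2_norm_eq_inner inner_coords crs_coords by (simp add: power2_eq_square algebra_simps)

text \<open>The right-hand side is the equality of the two cotangents, cleared of denominators.\<close>
lemma angle_eq_iff:
  assumes "crs (Y - X) (Z - X) \<noteq> 0" "0 < \<theta>" "\<theta> < pi"
  shows "angle Y X Z = \<theta> \<longleftrightarrow>
    \<bar>crs (Y - X) (Z - X)\<bar> * cos \<theta> = ((Y - X) \<bullet> (Z - X)) * sin \<theta>"
proof -
  define n where "n = norm (Y - X) * norm (Z - X)"
  define \<phi> where "\<phi> = angle Y X Z"
  have "Y \<noteq> X" "Z \<noteq> X" using assms(1) by (auto simp: crs_def)
  then have "0 < n" by (simp add: n_def)
  have bound: "\<bar>(Y - X) \<bullet> (Z - X) / n\<bar> \<le> 1" unfolding n_def by (rule cosine_bounds)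
  have \<phi>: "0 \<le> \<phi>" "\<phi> \<le> pi" "cos \<phi> = (Y - X) \<bullet> (Z - X) / n"
    using bound unfolding \<phi>_def angle_def n_def[symmetric] abs_le_iff
    by (auto intro!: arccos_lbound arccos_ubound cos_arccos)
  have "(n * cos \<phi>)\<^sup>2 + (n * sin \<phi>)\<^sup>2 = n\<^sup>2"
    by (simp add: power_mult_distrib flip: distrib_left)
  moreover have "n * cos \<phi> = (Y - X) \<bullet> (Z - X)" using \<phi>(3) \<open>0 < n\<close> by simp
  moreover have "((Y - X) \<bullet> (Z - X))\<^sup>2 + (crs (Y - X) (Z - X))\<^sup>2 = n\<^sup>2"
    by (simp add: inner_crs_power2 n_def power_mult_distrib)
  ultimately have "\<bar>crs (Y - X) (Z - X)\<bar>\<^sup>2 = (n * sin \<phi>)\<^sup>2" by simp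
  then have sin: "\<bar>crs (Y - X) (Z - X)\<bar> = n * sin \<phi>"
    by (rule power2_eq_imp_eq) (use \<open>0 < n\<close> sin_ge_zero[OF \<phi>(1,2)] in simp_all)
  have "\<bar>crs (Y - X) (Z - X)\<bar> * cos \<theta> = ((Y - X) \<bullet> (Z - X)) * sin \<theta> \<longleftrightarrow>
      n * (sin \<phi> * cos \<theta>) = n * (cos \<phi> * sin \<theta>)"
    unfolding sin \<open>n * cos \<phi> = _\<close>[symmetric] by (simp only: mult.assoc)
  also have "\<dots> \<longleftrightarrow> sin (\<phi> - \<theta>) = 0" using \<open>0 < n\<close> by (simp add: sin_diff)
  also have "\<dots> \<longleftrightarrow> \<phi> = \<theta>"
    using sin_gt_zero[of "\<phi> - \<theta>"] sin_gt_zero[of "\<theta> - \<phi>"] sin_minus[of "\<phi> - \<theta>"] \<phi>(1,2) assms(2,3)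
    by (cases \<phi> \<theta> rule: linorder_cases) auto
  finally show ?thesis by (simp add: \<phi>_def)
qed

text \<open>
  Unoriented angles determine the shape up to orientation: the triangles with given angles are those
  of the shapes \<open>(p, q)\<close> and \<open>(p, - q)\<close>.  In the proof, \<open>key\<close> expresses the three angles of the
  triangle of shape \<open>(p', s)\<close> and \<open>solve\<close> solves the resulting equations.
\<close>
lemma triangle_has_angles_iff:
  assumes angles: "0 < \<alpha>" "\<alpha> < pi" "0 < \<beta>" "\<beta> < pi" "0 < \<gamma>" "\<gamma> < pi" "\<alpha> + \<beta> + \<gamma> = pi"
    and p: "p = cos \<alpha> * sin \<beta> / sin \<gamma>" and q: "q = sin \<alpha> * sin \<beta> / sin \<gamma>"
  shows "triangle X Y Z \<and> has_angles \<alpha> \<beta> \<gamma> X Y Z \<longleftrightarrow>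
    X \<noteq> Y \<and> (\<exists>s\<in>{q, - q}. Z = apex p s X Y)"
proof -
  have pos: "0 < sin \<alpha>" "0 < sin \<beta>" "0 < sin \<gamma>" using angles by (simp_all add: sin_gt_zero)
  have "\<gamma> = pi - (\<alpha> + \<beta>)" using angles by simp
  then have \<gamma>: "sin \<gamma> = sin \<alpha> * cos \<beta> + cos \<alpha> * sin \<beta>"
    "cos \<gamma> = sin \<alpha> * sin \<beta> - cos \<alpha> * cos \<beta>"
    by (simp_all add: sin_diff cos_diff sin_add cos_add)
  have "0 < q" using pos q by simp
  have key: "triangle X Y (apex p' s X Y) \<and> has_angles \<alpha> \<beta> \<gamma> X Y (apex p' s X Y) \<longleftrightarrow>
      s \<noteq> 0 \<and> \<bar>s\<bar> * cos \<alpha> = p' * sin \<alpha> \<and> \<bar>s\<bar> * cos \<beta> = (1 - p') * sin \<beta> \<and>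
      \<bar>s\<bar> * cos \<gamma> = (p'\<^sup>2 + s\<^sup>2 - p') * sin \<gamma>" if "X \<noteq> Y" for p' s
  proof (cases "s = 0")
    case True
    then show ?thesis by (simp add: triangle_iff_crs crs_apex)
  next
    case False
    define W where "W = (Y - X) \<bullet> (Y - X)"
    have "0 < W" using that by (simp add: W_def)
    let ?Z = "apex p' s X Y"
    have crs: "crs (Y - X) (?Z - X) = s * W" "crs (X - Y) (?Z - Y) = - (s * W)"
      "crs (X - ?Z) (Y - ?Z) = s * W"
      unfolding W_def by (simp_all add: crs_coords inner_coords apex_coords algebra_simps)
    have dot: "(Y - X) \<bullet> (?Z - X) = p' * W" "(X - Y) \<bullet> (?Z - Y) = (1 - p') * W"
      "(X - ?Z) \<bullet> (Y - ?Z) = (p'\<^sup>2 + s\<^sup>2 - p') * W"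
      unfolding W_def by (simp_all add: inner_coords apex_coords algebra_simps power2_eq_square)
    have nz: "crs (Y - X) (?Z - X) \<noteq> 0" "crs (X - Y) (?Z - Y) \<noteq> 0" "crs (X - ?Z) (Y - ?Z) \<noteq> 0"
      unfolding crs using False \<open>0 < W\<close> by simp_all
    have cancel: "\<bar>s * W\<bar> * c = x * W * d \<longleftrightarrow> \<bar>s\<bar> * c = x * d" for c d x
      using \<open>0 < W\<close> by (simp add: abs_mult mult.assoc mult.left_commute[of W] mult.commute[of _ W])
    show ?thesis
      unfolding has_angles_def triangle_iff_crs angle_eq_iff[OF nz(1) angles(1,2)]
        angle_eq_iff[OF nz(2) angles(3,4)] angle_eq_iff[OF nz(3) angles(5,6)]
      unfolding crs dot using False \<open>0 < W\<close> by (simp add: cancel)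
  qed
  have solve: "s \<noteq> 0 \<and> \<bar>s\<bar> * cos \<alpha> = p' * sin \<alpha> \<and> \<bar>s\<bar> * cos \<beta> = (1 - p') * sin \<beta> \<and>
      \<bar>s\<bar> * cos \<gamma> = (p'\<^sup>2 + s\<^sup>2 - p') * sin \<gamma> \<longleftrightarrow> p' = p \<and> \<bar>s\<bar> = q" (is "?L \<longleftrightarrow> ?R") for p' s
  proof
    assume L: ?L
    then have "\<bar>s\<bar> * sin \<gamma> = sin \<alpha> * sin \<beta>" unfolding \<gamma> by algebra
    then have "\<bar>s\<bar> = q" using pos by (simp add: q field_simps)
    moreover have "sin \<alpha> * (p' * sin \<gamma>) = sin \<alpha> * (cos \<alpha> * sin \<beta>)"
      using L \<open>\<bar>s\<bar> * sin \<gamma> = _\<close> by algebra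
    then have "p' = p" using pos by (simp add: p field_simps)
    ultimately show ?R by simp
  next
    assume R: ?R
    then have s: "s\<^sup>2 = q\<^sup>2" by (metis power2_abs)
    have ps: "p * sin \<gamma> = cos \<alpha> * sin \<beta>" "q * sin \<gamma> = sin \<alpha> * sin \<beta>"
      using pos by (simp_all add: p q)
    have "q * cos \<alpha> = p * sin \<alpha>" by (simp add: p q)
    moreover have "sin \<gamma> * (q * cos \<beta>) = sin \<gamma> * ((1 - p) * sin \<beta>)"
      using ps \<gamma>(1) by algebra
    then have "q * cos \<beta> = (1 - p) * sin \<beta>" using pos by simp
    moreover have "sin \<gamma> * (q * cos \<gamma>) = sin \<gamma> * ((p\<^sup>2 + q\<^sup>2 - p) * sin \<gamma>)"
      using ps \<gamma> sin_cos_squared_add[of \<alpha>] by algebra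
    then have "q * cos \<gamma> = (p\<^sup>2 + q\<^sup>2 - p) * sin \<gamma>" using pos by simp
    ultimately show ?L using R s \<open>0 < q\<close> by auto
  qed
  show ?thesis
  proof (cases "X = Y")
    case True
    then show ?thesis by (simp add: triangle_def)
  next
    case False
    then obtain p' s where Z: "Z = apex p' s X Y" by (rule apex_exists)
    have inj: "apex p' s X Y = apex p s' X Y \<longleftrightarrow> p' = p \<and> s = s'" for s'
    proof
      assume *: "apex p' s X Y = apex p s' X Y"
      have "(Y - X) \<bullet> (apex a b X Y - X) = a * ((Y - X) \<bullet> (Y - X))" for a b
        by (simp add: inner_coords apex_coords algebra_simps)
      then have "p' * ((Y - X) \<bullet> (Y - X)) = p * ((Y - X) \<bullet> (Y - X))" using * by metis
      moreover have "s * ((Y - X) \<bullet> (Y - X)) = s' * ((Y - X) \<bullet> (Y - X))"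
        using * crs_apex by metis
      ultimately show "p' = p \<and> s = s'" using False by simp
    qed simp
    show ?thesis
      unfolding Z key[OF False] solve inj using False \<open>0 < q\<close> by auto
  qed
qed

section \<open>The two classes\<close>

text \<open>
  The vector that governs both extremal problems for triangles of shape \<open>(p, s)\<close>.  If such a triangle
  with base vector \<open>v\<close> is inscribed in \<open>ABC\<close>, then \<open>pivot \<bullet> v\<close> is minus the signed double area of
  \<open>ABC\<close>; if one with base vector \<open>w\<close> is circumscribed about \<open>ABC\<close>, then
  \<open>pivot \<bullet> w = - s (w \<bullet> w)\<close>.
\<close>
definition pivot :: "real \<Rightarrow> real \<Rightarrow> point \<Rightarrow> point \<Rightarrow> point \<Rightarrow> point" where
  "pivot p s A B C = rot90 (A - C) + p *\<^sub>R rot90 (B - A) + s *\<^sub>R (B - A)"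

lemma pivot_coords:
  "pivot p s A B C $ 1 = - (A $ 2 - C $ 2) - p * (B $ 2 - A $ 2) + s * (B $ 1 - A $ 1)"
  "pivot p s A B C $ 2 = (A $ 1 - C $ 1) + p * (B $ 1 - A $ 1) + s * (B $ 2 - A $ 2)"
  by (simp_all add: pivot_def algebra_simps)

lemma pivot_inscribed:
  "crs (C - B) (X - B) - crs (C - A) (Y - A) + crs (B - A) (apex p s X Y - A) =
   pivot p s A B C \<bullet> (Y - X) + crs (B - A) (C - A)"
  by (simp add: crs_coords inner_coords apex_coords pivot_coords algebra_simps)

lemma pivot_circumscribed:
  "crs (apex p s X Y - Y) (A - Y) - crs (apex p s X Y - X) (B - X) + crs (Y - X) (C - X) =
   pivot p s A B C \<bullet> (Y - X) + s * ((Y - X) \<bullet> (Y - X))"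
  by (simp add: crs_coords inner_coords apex_coords pivot_coords algebra_simps)

text \<open>
  If the base vector is parallel to the pivot vector, the right-hand side vanishes.  The perpendiculars
  to the side lines of \<open>ABC\<close> at the vertices of the inscribed triangle are then concurrent.
\<close>
lemma pivot_pedal:
  "(C - B) \<bullet> (K - X) - (C - A) \<bullet> (K - Y) + (B - A) \<bullet> (K - apex p s X Y) =
   rot90 (pivot p s A B C) \<bullet> (Y - X)"
  by (simp add: inner_coords apex_coords pivot_coords algebra_simps)

text \<open>
  Likewise, the perpendiculars at \<open>A\<close>, \<open>B\<close>, \<open>C\<close> to the sides of the circumscribed triangle are
  concurrent if its base vector is parallel to the pivot vector.
\<close>
lemma pivot_antipedal:
  "(apex p s X Y - Y) \<bullet> (L - A) - (apex p s X Y - X) \<bullet> (L - B) + (Y - X) \<bullet> (L - C) =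
   - (rot90 (pivot p s A B C) \<bullet> (Y - X))"
  by (simp add: inner_coords apex_coords pivot_coords algebra_simps)

text \<open>
  For a triangle \<open>ABC\<close> and \<open>s \<noteq> 0\<close>, of the shapes \<open>(p, s)\<close> and \<open>(p, - s)\<close> the one oriented like
  \<open>ABC\<close> has the strictly longer pivot vector.
\<close>
lemma pivot_norm_diff:
  "pivot p s A B C \<bullet> pivot p s A B C =
   pivot p (- s) A B C \<bullet> pivot p (- s) A B C + 4 * (s * crs (B - A) (C - A))"
  by (simp add: crs_coords inner_coords pivot_coords algebra_simps)

lemma triangle_distinct:
  assumes "triangle A B C"
  shows "A \<noteq> B" "A \<noteq> C" "B \<noteq> C"
  using assms by (auto simp: triangle_def insert_commute)

lemma inscribed_class_iff:
  assumes "triangle A B C"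
    and "0 < \<alpha>" "\<alpha> < pi" "0 < \<beta>" "\<beta> < pi" "0 < \<gamma>" "\<gamma> < pi" "\<alpha> + \<beta> + \<gamma> = pi"
    and "p = cos \<alpha> * sin \<beta> / sin \<gamma>" "q = sin \<alpha> * sin \<beta> / sin \<gamma>"
  shows "(X, Y, Z) \<in> inscribed_class A B C \<alpha> \<beta> \<gamma> \<longleftrightarrow>
    X \<noteq> Y \<and> (\<exists>s\<in>{q, - q}. Z = apex p s X Y) \<and>
    crs (C - B) (X - B) = 0 \<and> crs (C - A) (Y - A) = 0 \<and> crs (B - A) (Z - A) = 0"
  using triangle_has_angles_iff[OF assms(2-10), of X Y Z] triangle_distinct[OF assms(1)]
  by (auto simp: inscribed_class_def mem_line_through)

lemma circumscribed_class_iff: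
  assumes "0 < \<alpha>" "\<alpha> < pi" "0 < \<beta>" "\<beta> < pi" "0 < \<gamma>" "\<gamma> < pi" "\<alpha> + \<beta> + \<gamma> = pi"
    and "p = cos \<alpha> * sin \<beta> / sin \<gamma>" "q = sin \<alpha> * sin \<beta> / sin \<gamma>"
  shows "(X, Y, Z) \<in> circumscribed_class A B C \<alpha> \<beta> \<gamma> \<longleftrightarrow>
    X \<noteq> Y \<and> (\<exists>s\<in>{q, - q}. Z = apex p s X Y) \<and>
    crs (Z - Y) (A - Y) = 0 \<and> crs (Z - X) (B - X) = 0 \<and> crs (Y - X) (C - X) = 0"
proof -
  have "(X, Y, Z) \<in> circumscribed_class A B C \<alpha> \<beta> \<gamma> \<longleftrightarrow>
    (triangle X Y Z \<and> has_angles \<alpha> \<beta> \<gamma> X Y Z) \<and>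
    crs (Z - Y) (A - Y) = 0 \<and> crs (Z - X) (B - X) = 0 \<and> crs (Y - X) (C - X) = 0"
    using triangle_distinct[of X Y Z] by (auto simp: circumscribed_class_def mem_line_through)
  then show ?thesis using triangle_has_angles_iff[OF assms, of X Y Z] by blast
qed

lemma oriented_height:
  fixes S q :: real
  assumes "S \<noteq> 0" "0 < q" "s = sgn S * q"
  shows "s \<noteq> 0" "0 < s * S" "\<bar>s\<bar> = q" "{q, - q} = {s, - s}"
  using assms by (auto simp: sgn_if abs_if zero_less_mult_iff split: if_splits)

text \<open>
  Among the inscribed triangles of one orientation, the base vector ranges in a line
  \<open>N \<bullet> v = - S\<close>, and its shortest element is the multiple of \<open>N\<close> on that line.  The other
  orientation has a shorter pivot vector, hence only longer base vectors (or none at all).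
\<close>
lemma inscribed_minimizer:
  assumes "triangle A B C"
    and "0 < \<alpha>" "\<alpha> < pi" "0 < \<beta>" "\<beta> < pi" "0 < \<gamma>" "\<gamma> < pi" "\<alpha> + \<beta> + \<gamma> = pi"
    and p: "p = cos \<alpha> * sin \<beta> / sin \<gamma>" and q: "q = sin \<alpha> * sin \<beta> / sin \<gamma>"
    and S: "S = crs (B - A) (C - A)" and s: "s = sgn S * q"
    and N: "N = pivot p s A B C" and v: "v = - (S / (N \<bullet> N)) *\<^sub>R N"
  obtains X where
    "\<And>t. area_minimizing (inscribed_class A B C \<alpha> \<beta> \<gamma>) t \<longleftrightarrow> t = (X, X + v, apex p s X (X + v))"
proof -
  have "0 < q" using assms by (simp add: sin_gt_zero)
  have "S \<noteq> 0" using assms(1) by (simp add: S triangle_iff_crs)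
  note o = oriented_height[OF \<open>S \<noteq> 0\<close> \<open>0 < q\<close> s]
  define M where "M = pivot p (- s) A B C"
  have NM: "M \<bullet> M < N \<bullet> N"
    using pivot_norm_diff[of p s A B C] o(2) by (simp add: N M_def S)
  then have "0 < N \<bullet> N" using inner_ge_zero[of M] by linarith
  note mem = inscribed_class_iff[OF assms(1-8) p q]
  have vv: "v \<bullet> v = S\<^sup>2 / (N \<bullet> N)" "v \<noteq> 0" "N \<bullet> v = - S"
    using \<open>0 < N \<bullet> N\<close> \<open>S \<noteq> 0\<close> by (auto simp: v power2_eq_square field_simps)
  have "crs (rot90 (C - B)) (rot90 (C - A)) = - S"
    by (simp add: S crs_coords algebra_simps)
  then have "\<exists>!X. rot90 (C - B) \<bullet> X = rot90 (C - B) \<bullet> B \<and>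
      rot90 (C - A) \<bullet> X = rot90 (C - A) \<bullet> (A - v)" using \<open>S \<noteq> 0\<close> by (intro cramer) simp
  moreover have "rot90 (C - B) \<bullet> X = rot90 (C - B) \<bullet> B \<and> rot90 (C - A) \<bullet> X = rot90 (C - A) \<bullet> (A - v)
      \<longleftrightarrow> crs (C - B) (X - B) = 0 \<and> crs (C - A) (X + v - A) = 0" for X
    unfolding crs_def by (auto simp: inner_diff_right inner_add_right)
  ultimately have ex1: "\<exists>!X. crs (C - B) (X - B) = 0 \<and> crs (C - A) (X + v - A) = 0" by simp
  then obtain X where X: "crs (C - B) (X - B) = 0" "crs (C - A) (X + v - A) = 0" by blast
  define t where "t = (X, X + v, apex p s X (X + v))"
  have area: "triangle_area (X', Y', apex p s' X' Y') = q * ((Y' - X') \<bullet> (Y' - X')) / 2"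
    if "s' \<in> {s, - s}" for s' X' Y'
    using that o(3) by (auto simp: triangle_area_crs crs_apex abs_mult)
  have "crs (B - A) (apex p s X (X + v) - A) = 0"
    using pivot_inscribed[of C B X A "X + v" p s] X vv(3) by (simp add: N S)
  then have t_mem: "t \<in> inscribed_class A B C \<alpha> \<beta> \<gamma>"
    unfolding t_def mem o(4) using X vv(2) by simp
  have t_area: "triangle_area t = q * (v \<bullet> v) / 2"
    unfolding t_def using area[of s X "X + v"] by simp
  have best: "triangle_area t \<le> triangle_area (X', Y', Z') \<and>
      (triangle_area t = triangle_area (X', Y', Z') \<longrightarrow> (X', Y', Z') = t)"
    if "(X', Y', Z') \<in> inscribed_class A B C \<alpha> \<beta> \<gamma>" for X' Y' Z'
  proof -
    from that obtain s' where s': "s' \<in> {s, - s}" "Z' = apex p s' X' Y'" and "X' \<noteq> Y'"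
      and eqs: "crs (C - B) (X' - B) = 0" "crs (C - A) (Y' - A) = 0" "crs (B - A) (Z' - A) = 0"
      unfolding mem o(4) by blast
    define u where "u = Y' - X'"
    have "u \<noteq> 0" using \<open>X' \<noteq> Y'\<close> by (simp add: u_def)
    have piv: "pivot p s' A B C \<bullet> u = - S"
      using pivot_inscribed[of C B X' A Y' p s'] eqs by (simp add: s'(2) u_def S)
    have a: "triangle_area (X', Y', Z') = q * (u \<bullet> u) / 2"
      using area[OF s'(1)] by (simp add: s'(2) u_def)
    show ?thesis
    proof (cases "s' = s")
      case True
      then have "N \<bullet> u = - S" using piv by (simp add: N)
      \<comment> \<open>\<open>v\<close> is the orthogonal projection of \<open>u\<close> onto the direction of \<open>N\<close>.\<close>
      then have "u \<bullet> v = v \<bullet> v"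
        using \<open>0 < N \<bullet> N\<close> by (simp add: vv(1)) (simp add: v inner_commute power2_eq_square)
      then have uu: "u \<bullet> u = v \<bullet> v + (u - v) \<bullet> (u - v)"
        by (simp add: inner_diff_left inner_diff_right inner_commute)
      then have "v \<bullet> v \<le> u \<bullet> u" by simp
      then have "triangle_area t \<le> triangle_area (X', Y', Z')"
        unfolding t_area a using \<open>0 < q\<close> by simp
      moreover have "(X', Y', Z') = t" if "triangle_area t = triangle_area (X', Y', Z')"
      proof -
        have "u = v" using that uu \<open>0 < q\<close> unfolding t_area a by simp
        then have Y': "Y' = X' + v" by (simp add: u_def algebra_simps)
        then have "X' = X" using ex1 X eqs by blast
        then show ?thesis using Y' True s'(2) by (simp add: t_def)
      qed
      ultimately show ?thesis by blast
    next
      case False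
      then have "M \<bullet> u = - S" using piv s'(1) by (simp add: M_def)
      then have "S\<^sup>2 \<le> (M \<bullet> M) * (u \<bullet> u)" using Cauchy_Schwarz_ineq[of M u] by simp
      also have "\<dots> < (N \<bullet> N) * (u \<bullet> u)" using NM \<open>u \<noteq> 0\<close> by simp
      finally have "v \<bullet> v < u \<bullet> u" unfolding vv(1) using \<open>0 < N \<bullet> N\<close> by (simp add: field_simps)
      then have "triangle_area t < triangle_area (X', Y', Z')"
        unfolding t_area a using \<open>0 < q\<close> by simp
      then show ?thesis by simp
    qed
  qed
  have "area_minimizing (inscribed_class A B C \<alpha> \<beta> \<gamma>) t' \<longleftrightarrow> t' = t" for t'
  proof
    assume t': "area_minimizing (inscribed_class A B C \<alpha> \<beta> \<gamma>) t'"
    obtain X' Y' Z' where "t' = (X', Y', Z')" by (rule prod_cases3)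
    then show "t' = t"
      using t' best[of X' Y' Z'] t_mem unfolding area_minimizing_def by (metis order_antisym)
  next
    assume "t' = t"
    then show "area_minimizing (inscribed_class A B C \<alpha> \<beta> \<gamma>) t'"
      unfolding area_minimizing_def using t_mem best by auto
  qed
  then show thesis using that unfolding t_def by blast
qed

text \<open>
  Here the base vectors of one orientation lie on a circle \<open>N \<bullet> w + s (w \<bullet> w) = 0\<close> through the
  origin, and the longest is the diameter from the origin, \<open>- N / s\<close>.  For the other orientation
  the circle is smaller.
\<close>
lemma circumscribed_maximizer:
  assumes "triangle A B C"
    and "0 < \<alpha>" "\<alpha> < pi" "0 < \<beta>" "\<beta> < pi" "0 < \<gamma>" "\<gamma> < pi" "\<alpha> + \<beta> + \<gamma> = pi"
    and p: "p = cos \<alpha> * sin \<beta> / sin \<gamma>" and q: "q = sin \<alpha> * sin \<beta> / sin \<gamma>"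
    and S: "S = crs (B - A) (C - A)" and s: "s = sgn S * q"
    and N: "N = pivot p s A B C" and w: "w = - (1 / s) *\<^sub>R N"
  obtains X where
    "\<And>t. area_maximizing (circumscribed_class A B C \<alpha> \<beta> \<gamma>) t \<longleftrightarrow> t = (X, X + w, apex p s X (X + w))"
proof -
  have "0 < q" using assms by (simp add: sin_gt_zero)
  have "S \<noteq> 0" using assms(1) by (simp add: S triangle_iff_crs)
  note o = oriented_height[OF \<open>S \<noteq> 0\<close> \<open>0 < q\<close> s]
  define M where "M = pivot p (- s) A B C"
  have NM: "M \<bullet> M < N \<bullet> N"
    using pivot_norm_diff[of p s A B C] o(2) by (simp add: N M_def S)
  then have "0 < N \<bullet> N" using inner_ge_zero[of M] by linarith
  note mem = circumscribed_class_iff[OF assms(2-8) p q]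
  have ww: "w \<bullet> w = (N \<bullet> N) / s\<^sup>2" "w \<noteq> 0" "N \<bullet> w + s * (w \<bullet> w) = 0"
    using \<open>0 < N \<bullet> N\<close> o(1) by (auto simp: w power2_eq_square)
  have apex_dir: "apex p s X (X + w) - X = p *\<^sub>R w + s *\<^sub>R rot90 w" for X
    by (simp add: apex_def)
  define z where "z = p *\<^sub>R w + s *\<^sub>R rot90 w"
  \<comment> \<open>\<open>X\<close> is the intersection of the parallel to \<open>w\<close> through \<open>C\<close> with the parallel to \<open>z\<close>,
    the other side at \<open>X\<close>, through \<open>B\<close>.\<close>
  have "crs (rot90 w) (rot90 z) = s * (w \<bullet> w)"
    by (simp add: z_def crs_coords inner_coords algebra_simps)
  then have "\<exists>!X. rot90 w \<bullet> X = rot90 w \<bullet> C \<and> rot90 z \<bullet> X = rot90 z \<bullet> B"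
    using o(1) ww(2) by (intro cramer) simp
  moreover have "rot90 w \<bullet> X = rot90 w \<bullet> C \<and> rot90 z \<bullet> X = rot90 z \<bullet> B
      \<longleftrightarrow> crs w (C - X) = 0 \<and> crs z (B - X) = 0" for X
    unfolding crs_def by (auto simp: inner_diff_right)
  ultimately have ex1: "\<exists>!X. crs w (C - X) = 0 \<and> crs z (B - X) = 0" by simp
  then obtain X where X: "crs w (C - X) = 0" "crs z (B - X) = 0" by blast
  define t where "t = (X, X + w, apex p s X (X + w))"
  have area: "triangle_area (X', Y', apex p s' X' Y') = q * ((Y' - X') \<bullet> (Y' - X')) / 2"
    if "s' \<in> {s, - s}" for s' X' Y'
    using that o(3) by (auto simp: triangle_area_crs crs_apex abs_mult)
  have "crs (apex p s X (X + w) - (X + w)) (A - (X + w)) = 0"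
    using pivot_circumscribed[of p s X "X + w" A B C] X ww(3) by (simp add: N apex_dir z_def)
  then have t_mem: "t \<in> circumscribed_class A B C \<alpha> \<beta> \<gamma>"
    unfolding t_def mem o(4) using X ww(2) by (simp add: apex_dir z_def)
  have t_area: "triangle_area t = q * (w \<bullet> w) / 2"
    unfolding t_def using area[of s X "X + w"] by simp
  have best: "triangle_area (X', Y', Z') \<le> triangle_area t \<and>
      (triangle_area (X', Y', Z') = triangle_area t \<longrightarrow> (X', Y', Z') = t)"
    if "(X', Y', Z') \<in> circumscribed_class A B C \<alpha> \<beta> \<gamma>" for X' Y' Z'
  proof -
    from that obtain s' where s': "s' \<in> {s, - s}" "Z' = apex p s' X' Y'" and "X' \<noteq> Y'"
      and eqs: "crs (Z' - Y') (A - Y') = 0" "crs (Z' - X') (B - X') = 0" "crs (Y' - X') (C - X') = 0"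
      unfolding mem o(4) by blast
    define u where "u = Y' - X'"
    have "u \<noteq> 0" using \<open>X' \<noteq> Y'\<close> by (simp add: u_def)
    have piv: "pivot p s' A B C \<bullet> u = - s' * (u \<bullet> u)"
      using pivot_circumscribed[of p s' X' Y' A B C] eqs by (simp add: s'(2) u_def)
    have a: "triangle_area (X', Y', Z') = q * (u \<bullet> u) / 2"
      using area[OF s'(1)] by (simp add: s'(2) u_def)
    show ?thesis
    proof (cases "s' = s")
      case True
      then have "N \<bullet> u = - s * (u \<bullet> u)" using piv by (simp add: N)
      \<comment> \<open>Thales: \<open>u\<close> and \<open>w - u\<close> are orthogonal, since \<open>w\<close> is a diameter of the circle.\<close>
      then have "u \<bullet> w = u \<bullet> u" using o(1) by (simp add: w inner_commute)
      then have uu: "w \<bullet> w = u \<bullet> u + (u - w) \<bullet> (u - w)"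
        by (simp add: inner_diff_left inner_diff_right inner_commute)
      then have "u \<bullet> u \<le> w \<bullet> w" by simp
      then have "triangle_area (X', Y', Z') \<le> triangle_area t"
        unfolding t_area a using \<open>0 < q\<close> by simp
      moreover have "(X', Y', Z') = t" if "triangle_area (X', Y', Z') = triangle_area t"
      proof -
        have "u = w" using that uu \<open>0 < q\<close> unfolding t_area a by simp
        then have Y': "Y' = X' + w" by (simp add: u_def algebra_simps)
        then have "crs w (C - X') = 0 \<and> crs z (B - X') = 0"
          using eqs True s'(2) by (simp add: apex_dir z_def)
        then have "X' = X" using ex1 X by blast
        then show ?thesis using Y' True s'(2) by (simp add: t_def)
      qed
      ultimately show ?thesis by blast
    next
      case False
      then have "M \<bullet> u = s * (u \<bullet> u)" using piv s'(1) by (auto simp: M_def)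
      then have "(s * (u \<bullet> u))\<^sup>2 \<le> (M \<bullet> M) * (u \<bullet> u)" using Cauchy_Schwarz_ineq[of M u] by simp
      also have "\<dots> < (N \<bullet> N) * (u \<bullet> u)" using NM \<open>u \<noteq> 0\<close> by simp
      finally have "(s\<^sup>2 * (u \<bullet> u)) * (u \<bullet> u) < (N \<bullet> N) * (u \<bullet> u)"
        by (simp add: power2_eq_square mult_ac)
      then have "s\<^sup>2 * (u \<bullet> u) < N \<bullet> N" using \<open>u \<noteq> 0\<close> by (simp add: mult_less_cancel_right)
      then have "u \<bullet> u < w \<bullet> w" unfolding ww(1) using o(1) by (simp add: field_simps)
      then have "triangle_area (X', Y', Z') < triangle_area t"
        unfolding t_area a using \<open>0 < q\<close> by simp
      then show ?thesis by simp
    qed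
  qed
  have "area_maximizing (circumscribed_class A B C \<alpha> \<beta> \<gamma>) t' \<longleftrightarrow> t' = t" for t'
  proof
    assume t': "area_maximizing (circumscribed_class A B C \<alpha> \<beta> \<gamma>) t'"
    obtain X' Y' Z' where "t' = (X', Y', Z')" by (rule prod_cases3)
    then show "t' = t"
      using t' best[of X' Y' Z'] t_mem unfolding area_maximizing_def by (metis order_antisym)
  next
    assume "t' = t"
    then show "area_maximizing (circumscribed_class A B C \<alpha> \<beta> \<gamma>) t'"
      unfolding area_maximizing_def using t_mem best by auto
  qed
  then show thesis using that unfolding t_def by blast
qed

section \<open>Homothety\<close>

text \<open>
  The point \<open>H\<close> is the fixed point of the homothety of ratio \<open>k\<close> that takes \<open>EFD\<close> to \<open>QRS\<close>.
\<close>
lemma homotopy_center_scaled: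
  assumes "triangle E F D" "k \<noteq> 1" "R - Q = k *\<^sub>R (F - E)" "S - Q = k *\<^sub>R (D - E)"
    and H: "H = (1 / (1 - k)) *\<^sub>R (Q - k *\<^sub>R E)"
  shows "homotopy_center (E, F, D) (Q, R, S) H"
proof -
  have "(1 - k) *\<^sub>R H = Q - k *\<^sub>R E" using assms(2) by (simp add: H)
  then have Q: "Q = H + k *\<^sub>R (E - H)" by (simp add: algebra_simps)
  have R: "R = H + k *\<^sub>R (F - H)" and S: "S = H + k *\<^sub>R (D - H)"
    using assms(3,4) unfolding Q by (simp_all add: algebra_simps)
  have on_line: "crs (X - H) (V - H) = 0"
    if X: "X \<in> line_through V (H + k *\<^sub>R (V - H))" for X V
  proof -
    obtain a b where ab: "X = a *\<^sub>R V + b *\<^sub>R (H + k *\<^sub>R (V - H))" "a + b = 1"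
      using X by (auto simp: line_through_def affine_hull_2)
    then have "a = 1 - b" by simp
    then have "X - H = (a + b * k) *\<^sub>R (V - H)" unfolding ab(1) \<open>a = 1 - b\<close> by (simp add: algebra_simps)
    then show ?thesis by (simp add: crs_def)
  qed
  have center: "H \<in> line_through V (H + k *\<^sub>R (V - H))" for V
  proof -
    define b where "b = 1 / (1 - k)"
    have "b - k * b = 1" using assms(2) by (simp add: b_def field_simps)
    then have "(b - k * b) *\<^sub>R H = H" by simp
    moreover have "(- k * b) *\<^sub>R V + b *\<^sub>R (H + k *\<^sub>R (V - H)) = (b - k * b) *\<^sub>R H"
      by (simp add: algebra_simps)
    ultimately have "H = (- k * b) *\<^sub>R V + b *\<^sub>R (H + k *\<^sub>R (V - H))" "- k * b + b = 1"
      using \<open>b - k * b = 1\<close> by simp_all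
    then show ?thesis unfolding line_through_def affine_hull_2 by blast
  qed
  have "X = H" if "X \<in> line_through E Q" "X \<in> line_through F R" "X \<in> line_through D S" for X
    using triangle_vanish[OF assms(1), of "X - H" H] on_line that unfolding Q R S by auto
  then show ?thesis
    using center unfolding homotopy_center_def concur_at_def Q R S by auto
qed

lemma affine_parallel_line_through:
  assumes "U \<noteq> V" "k \<noteq> 0" "V' - U' = k *\<^sub>R (V - U)"
  shows "affine_parallel (line_through U V) (line_through U' V')"
proof -
  have "V' - U' \<noteq> 0" unfolding assms(3) using assms(1,2) by simp
  then have "U' \<noteq> V'" by auto
  then show ?thesis
    using affine_parallel_normal_line[OF assms(2), of "rot90 (V - U)" U U']
    by (simp add: line_through_eq assms)
qed

lemma homotopic_scaled:
  assumes "triangle E F D" "k \<noteq> 0" "R - Q = k *\<^sub>R (F - E)" "S - Q = k *\<^sub>R (D - E)"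
  shows "homotopic (E, F, D) (Q, R, S)"
proof -
  have "S - R = (S - Q) - (R - Q)" "Q - S = - (S - Q)" by simp_all
  then have "S - R = k *\<^sub>R (D - F)" "Q - S = k *\<^sub>R (E - D)"
    unfolding assms(3,4) by (simp_all add: algebra_simps)
  then show ?thesis
    using triangle_distinct[OF assms(1)] affine_parallel_line_through assms(2,3)
    unfolding homotopic_def by (metis (no_types, lifting) case_prod_conv)
qed

section \<open>Pedal and antipedal triangles\<close>

lemma pedal_triangle_iff:
  assumes "triangle A B C"
  shows "pedal_triangle A B C K (X, Y, Z) \<longleftrightarrow>
    crs (C - B) (X - B) = 0 \<and> crs (C - A) (Y - A) = 0 \<and> crs (B - A) (Z - A) = 0 \<and>
    (C - B) \<bullet> (X - K) = 0 \<and> (C - A) \<bullet> (Y - K) = 0 \<and> (B - A) \<bullet> (Z - K) = 0"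
  using triangle_distinct[OF assms]
  by (auto simp: pedal_triangle_def is_projection_line_through)

lemma antipedal_triangleI:
  assumes "triangle Q R S"
    and "crs (S - R) (A - R) = 0" "crs (S - Q) (B - Q) = 0" "crs (R - Q) (C - Q) = 0"
    and "(S - R) \<bullet> (L - A) = 0" "(S - Q) \<bullet> (L - B) = 0" "(R - Q) \<bullet> (L - C) = 0"
  shows "antipedal_triangle A B C L (Q, R, S)"
proof -
  have nz: "S - R \<noteq> 0" "S - Q \<noteq> 0" "R - Q \<noteq> 0"
    using triangle_distinct[OF assms(1)] by simp_all
  have joins: "joins (normal_line n V) L V" if "n \<noteq> 0" "n \<bullet> (L - V) = 0" for n V
    using that line_normal_line by (auto simp: joins_def mem_normal_line)
  have cr: "crs (R - Q) (S - Q) \<noteq> 0" using assms(1) by (simp add: triangle_iff_crs)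
  then have crs: "crs (rot90 (S - Q)) (rot90 (R - Q)) \<noteq> 0"
    "crs (rot90 (S - R)) (rot90 (R - Q)) \<noteq> 0"
    "crs (rot90 (S - R)) (rot90 (S - Q)) \<noteq> 0"
    by (simp_all add: crs_coords algebra_simps)
  have mem: "X \<in> normal_line (rot90 n) V \<longleftrightarrow> crs n (V - X) = 0" for X n V
    unfolding mem_normal_line crs_def by (auto simp: inner_diff_right)
  have on: "crs (S - R) (A - S) = 0" "crs (S - Q) (B - S) = 0" "crs (R - Q) (C - R) = 0"
    using assms(2-4) by (simp_all add: crs_coords algebra_simps)
  have "normal_line (rot90 (S - Q)) B \<inter> normal_line (rot90 (R - Q)) C = {Q}"
    "normal_line (rot90 (S - R)) A \<inter> normal_line (rot90 (R - Q)) C = {R}"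
    "normal_line (rot90 (S - R)) A \<inter> normal_line (rot90 (S - Q)) B = {S}"
    by (rule inter_normal_line; simp add: crs mem assms(2-4) on)+
  then show ?thesis
    unfolding antipedal_triangle_def prod.case
    using joins[OF nz(1) assms(5)] joins[OF nz(2) assms(6)] joins[OF nz(3) assms(7)]
      perp_through_normal_line[OF nz(1)] perp_through_normal_line[OF nz(2)]
      perp_through_normal_line[OF nz(3)]
    by metis
qed

section \<open>The extremal triangles\<close>

text \<open>
  An inscribed and a circumscribed triangle of the same shape whose base vectors are distinct
  multiples of the pivot vector have all the asserted properties; extremality is not used otherwise.
\<close>
lemma extremal_configuration:
  assumes ABC: "triangle A B C" and v: "v \<noteq> 0" and k: "k \<noteq> 0" "k \<noteq> 1" and s: "s \<noteq> 0"
    and par: "rot90 (pivot p s A B C) \<bullet> v = 0"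
    and D: "D = apex p s E F" and F: "F - E = v"
    and S: "S = apex p s Q R" and R: "R - Q = k *\<^sub>R v"
    and EFD: "crs (C - B) (E - B) = 0" "crs (C - A) (F - A) = 0" "crs (B - A) (D - A) = 0"
    and QRS: "crs (S - R) (A - R) = 0" "crs (S - Q) (B - Q) = 0" "crs (R - Q) (C - Q) = 0"
  shows "homotopic (E, F, D) (Q, R, S) \<and>
      (\<exists>K L T H.
        pedal_triangle A B C K (E, F, D) \<and>
        antipedal_triangle A B C L (Q, R, S) \<and>
        concur_at (perp_through Q (line_through B C))
                  (perp_through R (line_through A C))
                  (perp_through S (line_through A B)) T \<and>
        isogonal_pair A B C L K \<and>
        isogonal_pair Q R S T L \<and>
        homotopy_center (E, F, D) (Q, R, S) H \<and>
        collinear {H, K, T})"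
proof -
  have ne: "A \<noteq> B" "A \<noteq> C" "B \<noteq> C" using triangle_distinct[OF ABC] by auto
  have FE: "R - Q = k *\<^sub>R (F - E)" using R F by simp
  have DE: "S - Q = k *\<^sub>R (D - E)"
    by (simp add: S D apex_def FE scaleR_right_distrib mult.commute)
  have DF: "S - R = k *\<^sub>R (D - F)"
  proof -
    have "S - R = (S - Q) - (R - Q)" by simp
    then show ?thesis unfolding FE DE by (simp add: algebra_simps)
  qed
  have tE: "triangle E F D" using crs_apex[of F E p s] v s by (simp add: triangle_iff_crs D F)
  have tQ: "triangle Q R S" using crs_apex[of R Q p s] v s k by (simp add: triangle_iff_crs S R)

  have "crs (C - B) (C - A) \<noteq> 0"
    using ABC by (simp add: triangle_iff_crs crs_coords algebra_simps)
  from cramer[OF this, of "(C - B) \<bullet> E" "(C - A) \<bullet> F"] obtain K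
    where "(C - B) \<bullet> K = (C - B) \<bullet> E" "(C - A) \<bullet> K = (C - A) \<bullet> F" by blast
  then have K: "(C - B) \<bullet> (K - E) = 0" "(C - A) \<bullet> (K - F) = 0" by (simp_all add: inner_diff_right)
  then have K3: "(B - A) \<bullet> (K - D) = 0"
    using pivot_pedal[of C B K E A F p s] par by (simp add: D F)
  have pedal: "pedal_triangle A B C K (E, F, D)"
    using K K3 EFD unfolding pedal_triangle_iff[OF ABC] by (simp add: inner_diff_right)

  have "crs (S - Q) (R - Q) \<noteq> 0"
    using tQ by (simp add: triangle_iff_crs crs_coords algebra_simps)
  from cramer[OF this, of "(S - Q) \<bullet> B" "(R - Q) \<bullet> C"] obtain L
    where "(S - Q) \<bullet> L = (S - Q) \<bullet> B" "(R - Q) \<bullet> L = (R - Q) \<bullet> C" by blast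
  then have L: "(S - Q) \<bullet> (L - B) = 0" "(R - Q) \<bullet> (L - C) = 0" by (simp_all add: inner_diff_right)
  then have L3: "(S - R) \<bullet> (L - A) = 0"
    using pivot_antipedal[of p s Q R L A B C] par k(1) by (simp add: S R)
  have antipedal: "antipedal_triangle A B C L (Q, R, S)"
    using antipedal_triangleI[OF tQ QRS L3 L] .

  \<comment> \<open>\<open>T\<close> is the image of \<open>K\<close> under the homothety: it carries the perpendicular to \<open>BC\<close> at \<open>E\<close> to
    the one through \<open>Q\<close>, and likewise for the other vertices.\<close>
  define T where "T = Q + k *\<^sub>R (K - E)"
  have TQ: "T - Q = k *\<^sub>R (K - E)" by (simp add: T_def)
  have "T - R = (T - Q) - (R - Q)" "T - S = (T - Q) - (S - Q)" by simp_all
  then have TR: "T - R = k *\<^sub>R (K - F)" and TS: "T - S = k *\<^sub>R (K - D)"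
    unfolding TQ FE DE by (simp_all add: algebra_simps)
  have T: "(C - B) \<bullet> (T - Q) = 0" "(C - A) \<bullet> (T - R) = 0" "(B - A) \<bullet> (T - S) = 0"
    unfolding TQ TR TS using K K3 by simp_all
  have concur: "concur_at (perp_through Q (line_through B C))
      (perp_through R (line_through A C)) (perp_through S (line_through A B)) T"
    unfolding perp_through_line_through[OF ne(1)] perp_through_line_through[OF ne(2)]
      perp_through_line_through[OF ne(3)]
    by (rule concur_at_normal_lines[OF tQ]) (use ne T in \<open>simp_all add: mem_normal_line\<close>)

  have "(D - F) \<bullet> (L - A) = 0" "(D - E) \<bullet> (L - B) = 0" "(F - E) \<bullet> (L - C) = 0"
    using L L3 k(1) unfolding FE DE DF by simp_all
  then have isoK: "isogonal_pair A B C L K" by (rule isogonal_pair_pedal[OF ABC tE pedal])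
  \<comment> \<open>Conversely \<open>ABC\<close> is the pedal triangle of \<open>L\<close> in \<open>QRS\<close>, so the same criterion applies.\<close>
  have "pedal_triangle Q R S L (A, B, C)"
    using QRS L L3 unfolding pedal_triangle_iff[OF tQ] by (simp add: inner_diff_right)
  then have isoT: "isogonal_pair Q R S T L" using T by (rule isogonal_pair_pedal[OF tQ ABC])

  define H where "H = (1 / (1 - k)) *\<^sub>R (Q - k *\<^sub>R E)"
  have center: "homotopy_center (E, F, D) (Q, R, S) H"
    by (rule homotopy_center_scaled[OF tE k(2) FE DE H_def])
  have "(1 - k) *\<^sub>R H = Q - k *\<^sub>R E" using k(2) by (simp add: H_def)
  then have "T - H = k *\<^sub>R (K - H)" by (simp add: T_def algebra_simps)
  then have "crs (K - H) (T - H) = 0" by (simp add: crs_def)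
  then have "collinear {H, K, T}" using triangle_iff_crs[of H K T] by (simp add: triangle_def)
  then show ?thesis
    using homotopic_scaled[OF tE k(1) FE DE] pedal antipedal concur isoK isoT center by blast
qed

theorem theorem2p4:
  fixes A B C :: point and \<alpha> \<beta> \<gamma> :: real
  assumes "triangle A B C"
    and "0 < \<alpha>" "\<alpha> < pi" "0 < \<beta>" "\<beta> < pi" "0 < \<gamma>" "\<gamma> < pi"
    and "\<alpha> + \<beta> + \<gamma> = pi"
  shows "(\<exists>!t. area_minimizing (inscribed_class A B C \<alpha> \<beta> \<gamma>) t) \<and>
    (\<exists>!t. area_maximizing (circumscribed_class A B C \<alpha> \<beta> \<gamma>) t) \<and>
    (\<forall>E F D Q R S.
      area_minimizing (inscribed_class A B C \<alpha> \<beta> \<gamma>) (E, F, D) \<longrightarrow>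
      area_maximizing (circumscribed_class A B C \<alpha> \<beta> \<gamma>) (Q, R, S) \<longrightarrow>
      homotopic (E, F, D) (Q, R, S) \<and>
      (\<exists>K L T H.
        pedal_triangle A B C K (E, F, D) \<and>
        antipedal_triangle A B C L (Q, R, S) \<and>
        concur_at (perp_through Q (line_through B C))
                  (perp_through R (line_through A C))
                  (perp_through S (line_through A B)) T \<and>
        isogonal_pair A B C L K \<and>
        isogonal_pair Q R S T L \<and>
        homotopy_center (E, F, D) (Q, R, S) H \<and>
        collinear {H, K, T}))"
proof -
  define p q where "p = cos \<alpha> * sin \<beta> / sin \<gamma>" and "q = sin \<alpha> * sin \<beta> / sin \<gamma>"
  define \<Delta> where "\<Delta> = crs (B - A) (C - A)"
  \<comment> \<open>The sign makes the shape \<open>(p, s)\<close> equally oriented with \<open>ABC\<close>.\<close>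
  define s where "s = sgn \<Delta> * q"
  define N where "N = pivot p s A B C"
  define v w where "v = - (\<Delta> / (N \<bullet> N)) *\<^sub>R N" and "w = - (1 / s) *\<^sub>R N"
  have "0 < q" using assms by (simp add: q_def sin_gt_zero)
  have "\<Delta> \<noteq> 0" using assms(1) by (simp add: \<Delta>_def triangle_iff_crs)
  note o = oriented_height[OF \<open>\<Delta> \<noteq> 0\<close> \<open>0 < q\<close> s_def]
  have N: "4 * (s * \<Delta>) \<le> N \<bullet> N"
    using pivot_norm_diff[of p s A B C] inner_ge_zero[of "pivot p (- s) A B C"]
    by (simp add: N_def \<Delta>_def)
  then have "0 < N \<bullet> N" using o(2) by linarith
  \<comment> \<open>The ratio of the homothety from the minimizing to the maximizing triangle.\<close>
  define k where "k = (N \<bullet> N) / (s * \<Delta>)"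
  have "4 \<le> k" using N o(2) by (simp add: k_def field_simps)
  have w: "w = k *\<^sub>R v"
    using \<open>0 < N \<bullet> N\<close> \<open>\<Delta> \<noteq> 0\<close> o(1) by (simp add: w_def v_def k_def)
  have "v \<noteq> 0" using \<open>0 < N \<bullet> N\<close> \<open>\<Delta> \<noteq> 0\<close> by (auto simp: v_def)
  have par: "rot90 N \<bullet> v = 0" by (simp add: v_def)
  obtain X where X: "\<And>t. area_minimizing (inscribed_class A B C \<alpha> \<beta> \<gamma>) t \<longleftrightarrow>
      t = (X, X + v, apex p s X (X + v))"
    using inscribed_minimizer[OF assms p_def q_def \<Delta>_def s_def N_def v_def] by blast
  obtain Y where Y: "\<And>t. area_maximizing (circumscribed_class A B C \<alpha> \<beta> \<gamma>) t \<longleftrightarrow>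
      t = (Y, Y + w, apex p s Y (Y + w))"
    using circumscribed_maximizer[OF assms p_def q_def \<Delta>_def s_def N_def w_def] by blast
  have "(X, X + v, apex p s X (X + v)) \<in> inscribed_class A B C \<alpha> \<beta> \<gamma>"
    using X by (auto simp: area_minimizing_def)
  then have ins: "crs (C - B) (X - B) = 0" "crs (C - A) (X + v - A) = 0"
    "crs (B - A) (apex p s X (X + v) - A) = 0"
    unfolding inscribed_class_iff[OF assms p_def q_def] by blast+
  have "(Y, Y + w, apex p s Y (Y + w)) \<in> circumscribed_class A B C \<alpha> \<beta> \<gamma>"
    using Y by (auto simp: area_maximizing_def)
  then have circ: "crs (apex p s Y (Y + w) - (Y + w)) (A - (Y + w)) = 0"
    "crs (apex p s Y (Y + w) - Y) (B - Y) = 0" "crs (Y + w - Y) (C - Y) = 0"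
    unfolding circumscribed_class_iff[OF assms(2-) p_def q_def] by blast+
  have k: "k \<noteq> 0" "k \<noteq> 1" using \<open>4 \<le> k\<close> by simp_all
  note conf = extremal_configuration[OF assms(1) \<open>v \<noteq> 0\<close> k o(1) par[unfolded N_def] refl _ refl _ ins circ]
  show ?thesis
    unfolding X Y using conf w by simp
qed

end
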